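(* $\mathsf{SRT}^2_2 \not\le_{\rm sc} \mathsf{SPT}^2_2$.
   Context: A 2-coloring of pairs is $f:[\omega]^2\to 2$, with $f(x,y)$ meaning $f(\{x,y\})$ for $x<y$; it is stable if $\lim_u f(x,u)$ exists for all $x$. $A\oplus B=\{2x:x\in A\}\cup\{2y+1:y\in B\}$. An infinite set $H$ is homogeneous for $f$ if $f$ is constant on $[H]^2$. A set $H=H_L\oplus H_R$ with $H_L,H_R$ infinite is p-homogeneous for $f$ if $f(\{x,y\})$ is constant over $x\in H_L$, $y\in H_R$, $x\neq y$. $\mathsf{SRT}^2_2$ (resp. $\mathsf{SPT}^2_2$) is the problem whose instances are stable 2-colorings of pairs $f$ and whose solutions are sets homogeneous (resp. p-homogeneous) for $f$. $\mathsf P\le_{\rm sc}\mathsf Q$ if every instance $X$ of $\mathsf P$ computes an instance $\widehat X$ of $\mathsf Q$ such that every solution $\widehat Y$ of $\widehat X$ computes some solution of $X$. *)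

theory Defs
  imports Main "HOL-Library.Nat_Bijection"
begin

datatype recf = Zero | Succ | Proj nat | Comp recf "recf list" | Prim recf recf | Mn recf | Oracle

inductive eval :: "(nat \<Rightarrow> nat) \<Rightarrow> recf \<Rightarrow> nat list \<Rightarrow> nat \<Rightarrow> bool" for A where
  ev_zero: "eval A Zero xs 0"
| ev_succ: "eval A Succ (x # xs) (Suc x)"
| ev_proj: "i < length xs \<Longrightarrow> eval A (Proj i) xs (xs ! i)"
| ev_oracle: "eval A Oracle (x # xs) (A x)"
| ev_comp: "length hs = length ys \<Longrightarrow> (\<forall>i<length hs. eval A (hs ! i) xs (ys ! i))
            \<Longrightarrow> eval A g ys z \<Longrightarrow> eval A (Comp g hs) xs z"
| ev_prim0: "eval A g xs z \<Longrightarrow> eval A (Prim g h) (0 # xs) z"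
| ev_primS: "eval A (Prim g h) (n # xs) y \<Longrightarrow> eval A h (n # y # xs) z
            \<Longrightarrow> eval A (Prim g h) (Suc n # xs) z"
| ev_mn: "eval A g (n # xs) 0 \<Longrightarrow> (\<forall>m<n. \<exists>y. eval A g (m # xs) (Suc y))
            \<Longrightarrow> eval A (Mn g) xs n"

definition turing_le :: "(nat \<Rightarrow> nat) \<Rightarrow> (nat \<Rightarrow> nat) \<Rightarrow> bool" where
  "turing_le B A \<longleftrightarrow> (\<exists>p. \<forall>n. eval A p [n] (B n))"

definition chi :: "nat set \<Rightarrow> nat \<Rightarrow> nat" where
  "chi X n = (if n \<in> X then 1 else 0)"

text \<open>A 2-coloring of pairs is f :: nat \<Rightarrow> nat \<Rightarrow> bool, where f x y (for x < y) is the
  colour of {x,y}; values with x \<ge> y are irrelevant.\<close>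

definition col :: "(nat \<Rightarrow> nat \<Rightarrow> bool) \<Rightarrow> nat \<Rightarrow> nat \<Rightarrow> bool" where
  "col f x y = f (min x y) (max x y)"

definition code :: "(nat \<Rightarrow> nat \<Rightarrow> bool) \<Rightarrow> nat \<Rightarrow> nat" where
  "code f n = (case prod_decode n of (x, y) \<Rightarrow> if x < y \<and> f x y then 1 else 0)"

definition stable :: "(nat \<Rightarrow> nat \<Rightarrow> bool) \<Rightarrow> bool" where
  "stable f \<longleftrightarrow> (\<forall>x. \<exists>c N. \<forall>u>N. col f x u = c)"

definition join :: "nat set \<Rightarrow> nat set \<Rightarrow> nat set" where
  "join A B = {2 * x | x. x \<in> A} \<union> {2 * y + 1 | y. y \<in> B}"

definition homogeneous :: "(nat \<Rightarrow> nat \<Rightarrow> bool) \<Rightarrow> nat set \<Rightarrow> bool" where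
  "homogeneous f H \<longleftrightarrow> infinite H \<and> (\<exists>c. \<forall>x\<in>H. \<forall>y\<in>H. x < y \<longrightarrow> f x y = c)"

text \<open>join HL HR is p-homogeneous for f.\<close>
definition p_homogeneous :: "(nat \<Rightarrow> nat \<Rightarrow> bool) \<Rightarrow> nat set \<Rightarrow> nat set \<Rightarrow> bool" where
  "p_homogeneous f HL HR \<longleftrightarrow> infinite HL \<and> infinite HR \<and>
     (\<exists>c. \<forall>x\<in>HL. \<forall>y\<in>HR. x \<noteq> y \<longrightarrow> col f x y = c)"

definition SRT22_sc_le_SPT22 :: bool where
  "SRT22_sc_le_SPT22 \<longleftrightarrow>
    (\<forall>f. stable f \<longrightarrow>
      (\<exists>g. turing_le (code g) (code f) \<and> stable g \<and>
         (\<forall>HL HR. p_homogeneous g HL HR \<longrightarrow>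
            (\<exists>H. homogeneous f H \<and> turing_le (chi H) (chi (join HL HR))))))"

end

theory Submission
  imports Defs "HOL-Library.Countable_Set"
begin

text \<open>
  The instance \<open>f\<close> is a generic stable coloring for finite conditions that fix an initial segment of
  \<open>f\<close> and promise finitely many limits. For a computed stable coloring \<open>g\<close> the two sides of a solution
  of one color \<open>c\<close> are built generically inside one set \<open>X\<close> that is so thin that for every functional,
  every finite stem and every number \<open>w\<close>, either each infinite subset of \<open>X\<close> contains an extension
  of the stem that prints \<open>w\<close>, or none does eventually.

  If for both colors some functional could not be defeated, then there would be infinitely many \<open>x\<close>
  in \<open>X\<close> such that adding \<open>x\<close> to a stem of color \<open>c\<close> forces a new number to be printed, whose limit
  under \<open>f\<close> is thereby prescribed. Since \<open>x\<close> joins a stem of one of the two colors, both prescriptions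
  must concern the same number \<open>z x\<close>, so that the limit of \<open>g\<close> at \<open>x\<close> mirrors the limit of \<open>f\<close> at
  \<open>z x\<close>. Now take two such elements \<open>x1 < x2\<close> on the same side, with the finitely many further elements
  needed for printing in between, and keep the limit of \<open>f\<close> at \<open>z x1\<close> wrong until \<open>x2\<close> has been
  chosen. As the color of \<open>g\<close> between elements of one side is irrelevant, restoring the limit afterwards
  gives a correct stem, but the pair \<open>z x1\<close>, \<open>z x2\<close> has the wrong color for \<open>f\<close>.
\<close>

instance recf :: countable
  by countable_datatype

subsection \<open>Oracle computations\<close>

inductive_cases eval_ZeroE: "eval A Zero xs y"
inductive_cases eval_SuccE: "eval A Succ xs y"
inductive_cases eval_ProjE: "eval A (Proj i) xs y"
inductive_cases eval_OracleE: "eval A Oracle xs y"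
inductive_cases eval_CompE: "eval A (Comp g hs) xs y"

lemma eval_det: "eval A p xs y \<Longrightarrow> eval A p xs z \<Longrightarrow> y = z"
proof (induction arbitrary: z rule: eval.induct)
  case (ev_zero xs)
  then show ?case by (elim eval_ZeroE) auto
next
  case (ev_succ x xs)
  then show ?case by (elim eval_SuccE) auto
next
  case (ev_proj i xs)
  then show ?case by (elim eval_ProjE) auto
next
  case (ev_oracle x xs)
  then show ?case by (elim eval_OracleE) auto
next
  case (ev_comp hs ys xs g v)
  from ev_comp.prems obtain ys' where ys': "length hs = length ys'"
    "\<forall>i<length hs. eval A (hs ! i) xs (ys' ! i)" "eval A g ys' z"
    by (elim eval_CompE) auto
  have "ys = ys'"
    using ev_comp.hyps ev_comp.IH ys' by (intro nth_equalityI) auto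
  then show ?case using ev_comp.IH(2) ys'(3) by blast
next
  case (ev_prim0 g xs v h)
  from ev_prim0.prems have "eval A g xs z" by (cases rule: eval.cases) auto
  then show ?case by (rule ev_prim0.IH)
next
  case (ev_primS g h n xs y v)
  from ev_primS.prems obtain y' where y': "eval A (Prim g h) (n # xs) y'" "eval A h (n # y' # xs) z"
    by (cases rule: eval.cases) auto
  have "y = y'" using y'(1) by (rule ev_primS.IH(1))
  then show ?case using y'(2) ev_primS.IH(2) by blast
next
  case (ev_mn g n xs)
  from ev_mn.prems have z: "eval A g (z # xs) 0" "\<forall>m<z. \<exists>y. eval A g (m # xs) (Suc y)"
    by (cases rule: eval.cases; simp)+
  have "\<not> z < n" using ev_mn.IH(2) z(1) by (metis nat.distinct(1))
  moreover have "\<not> n < z" using ev_mn.IH(1) z(2) by (metis nat.distinct(1))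
  ultimately show ?case by simp
qed

text \<open>The use principle: a convergent computation asks the oracle only finitely many
  questions. A sum of finitely many use bounds dominates each of them, which settles composition and
  minimization.\<close>

lemma eval_use: "eval A p xs y \<Longrightarrow> \<exists>N. \<forall>B. (\<forall>n<N. B n = A n) \<longrightarrow> eval B p xs y"
proof (induction rule: eval.induct)
  case (ev_oracle x xs)
  have "eval B Oracle (x # xs) (A x)" if "\<forall>n<Suc x. B n = A n" for B
    using that eval.ev_oracle[of B x xs] by simp
  then show ?case by blast
next
  case (ev_comp hs ys xs g v)
  from ev_comp.IH(1) obtain N where
    N: "\<And>i B. i < length hs \<Longrightarrow> \<forall>n<N i. B n = A n \<Longrightarrow> eval B (hs ! i) xs (ys ! i)"
    by metis
  from ev_comp.IH(2) obtain M where M: "\<And>B. \<forall>n<M. B n = A n \<Longrightarrow> eval B g ys v"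
    by blast
  have "eval B (Comp g hs) xs v" if "\<forall>n < M + sum N {..<length hs}. B n = A n" for B
  proof (rule eval.ev_comp)
    show "\<forall>i<length hs. eval B (hs ! i) xs (ys ! i)"
    proof (intro allI impI N)
      fix i n assume "i < length hs" "n < N i"
      moreover from this have "N i \<le> sum N {..<length hs}" by (intro member_le_sum) auto
      ultimately show "B n = A n" using that by auto
    qed
  qed (use ev_comp.hyps that M in auto)
  then show ?case by blast
next
  case (ev_primS g h n xs y v)
  then obtain N M where "\<And>B. \<forall>n<N. B n = A n \<Longrightarrow> eval B (Prim g h) (n # xs) y"
    "\<And>B. \<forall>n<M. B n = A n \<Longrightarrow> eval B h (n # y # xs) v" by meson
  then have "eval B (Prim g h) (Suc n # xs) v" if "\<forall>n < N + M. B n = A n" for B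
    using that by (meson eval.ev_primS trans_less_add1 trans_less_add2)
  then show ?case by blast
next
  case (ev_mn g n xs)
  from ev_mn.IH(2) obtain N Y where
    N: "\<And>i B. i < n \<Longrightarrow> \<forall>k<N i. B k = A k \<Longrightarrow> eval B g (i # xs) (Suc (Y i))"
    by metis
  from ev_mn.IH(1) obtain M where M: "\<And>B. \<forall>k<M. B k = A k \<Longrightarrow> eval B g (n # xs) 0"
    by blast
  have "eval B (Mn g) xs n" if B: "\<forall>k < M + sum N {..<n}. B k = A k" for B
  proof (rule eval.ev_mn)
    have "eval B g (i # xs) (Suc (Y i))" if "i < n" for i
    proof (intro N that allI impI)
      fix k assume "k < N i"
      moreover from that have "N i \<le> sum N {..<n}" by (intro member_le_sum) auto
      ultimately show "B k = A k" using B by auto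
    qed
    then show "\<forall>m<n. \<exists>y. eval B g (m # xs) (Suc y)" by blast
  qed (use B M in auto)
  then show ?case by blast
qed (blast intro: eval.intros)+

text \<open>Output 1 with use bounded by \<open>m\<close>: the part of the oracle from
  \<open>m\<close> on is irrelevant, so the output survives when a stem is extended only above
  \<open>m\<close>.\<close>

definition computes :: "recf \<Rightarrow> nat \<Rightarrow> nat set \<Rightarrow> nat \<Rightarrow> bool" where
  "computes \<psi> m E w \<longleftrightarrow> (\<forall>A. A \<inter> {..<m} = E \<inter> {..<m} \<longrightarrow> eval (chi A) \<psi> [w] 1)"

lemma computes_eval: "computes \<psi> m E w \<Longrightarrow> A \<inter> {..<m} = E \<inter> {..<m} \<Longrightarrow> eval (chi A) \<psi> [w] 1"
  unfolding computes_def by blast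

lemma computes_mono:
  assumes "computes \<psi> m E w" "m \<le> m'" "E' \<inter> {..<m} = E \<inter> {..<m}"
  shows "computes \<psi> m' E' w"
  unfolding computes_def
proof (intro allI impI)
  fix A assume A: "A \<inter> {..<m'} = E' \<inter> {..<m'}"
  have "{..<m'} \<inter> {..<m} = {..<m}" using assms(2) by auto
  then have "A \<inter> {..<m} = E' \<inter> {..<m}" using A by (metis Int_assoc)
  also note assms(3)
  finally show "eval (chi A) \<psi> [w] 1" by (rule computes_eval[OF assms(1)])
qed

lemma eval_computes:
  assumes "eval (chi A) \<psi> [w] 1"
  obtains m where "computes \<psi> m A w"
proof -
  obtain N where N: "\<And>B. \<forall>n<N. B n = chi A n \<Longrightarrow> eval B \<psi> [w] 1"
    using eval_use[OF assms] by blast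
  have "computes \<psi> N A w"
    unfolding computes_def
  proof (intro allI impI N)
    fix B n assume "B \<inter> {..<N} = A \<inter> {..<N}" "n < N"
    then have "n \<in> B \<longleftrightarrow> n \<in> A" by blast
    then show "chi B n = chi A n" by (simp add: chi_def)
  qed
  then show thesis by (rule that)
qed

text \<open>The code of a pair is at least its second component, so a use bound for the coded oracle
  also bounds the pairs whose colors matter.\<close>

lemma eval_code_use:
  assumes "eval (code f) p xs v"
  obtains N where "\<And>h. (\<And>a b. a < b \<Longrightarrow> b < N \<Longrightarrow> h a b = f a b) \<Longrightarrow> eval (code h) p xs v"
proof -
  obtain N where N: "\<And>B. \<forall>n<N. B n = code f n \<Longrightarrow> eval B p xs v"
    using eval_use[OF assms] by blast
  have "eval (code h) p xs v" if h: "\<And>a b. a < b \<Longrightarrow> b < N \<Longrightarrow> h a b = f a b" for h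
  proof (intro N allI impI)
    fix n assume "n < N"
    obtain a b where ab: "prod_decode n = (a, b)" by fastforce
    then have "n = prod_encode (a, b)" by (metis prod_decode_inverse)
    then have "b < N" using le_prod_encode_2[of b a] \<open>n < N\<close> by simp
    then show "code h n = code f n" using h[of a b] ab by (auto simp: code_def)
  qed
  then show thesis by (rule that)
qed

subsection \<open>Finite extensions inside a reservoir\<close>

text \<open>A pair of sets is handled through its join: the number coded by \<open>k\<close> is \<open>k div 2\<close>, and its
  side is the parity of \<open>k\<close>. Injectivity of \<open>k \<mapsto> k div 2\<close> keeps the two sides disjoint.\<close>

definition tag :: "bool \<Rightarrow> nat \<Rightarrow> nat" where
  "tag s x = 2 * x + of_bool s"

lemma tag_simps [simp]: "tag s x div 2 = x" "odd (tag s x) = s" "even (tag s x) = (\<not> s)"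
  by (auto simp: tag_def)

lemma tag_odd_div [simp]: "tag (odd k) (k div 2) = k"
  by (simp add: tag_def)

lemma tag_ge: "x \<le> tag s x" "2 * x \<le> tag s x"
  by (auto simp: tag_def)

lemma div2_less_iff: "k div 2 < n \<longleftrightarrow> k < 2 * (n::nat)"
  by auto

lemma inj_div2_less:
  assumes "inj_on (\<lambda>k. k div 2) E" "j \<in> E" "k \<in> E" "j < (k::nat)"
  shows "j div 2 < k div 2"
proof -
  have "j div 2 \<noteq> k div 2"
    using inj_on_eq_iff[OF assms(1-3)] assms(4) by simp
  then show ?thesis using div_le_mono[of j k 2] assms(4) by simp
qed

text \<open>Extension of a stem as in Mathias forcing, with \<open>Y\<close> as the reservoir for
  both sides. Nothing says that new numbers are larger than old ones; this is imposed through tails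
  \<open>Y \<inter> {n..}\<close>.\<close>

definition over :: "nat set \<Rightarrow> nat set \<Rightarrow> nat set \<Rightarrow> bool" where
  "over Y E E' \<longleftrightarrow> finite E' \<and> inj_on (\<lambda>k. k div 2) E' \<and> E \<subseteq> E' \<and> (\<forall>k\<in>E' - E. k div 2 \<in> Y)"

lemma over_finite: "over Y E E' \<Longrightarrow> finite E'"
  and over_inj: "over Y E E' \<Longrightarrow> inj_on (\<lambda>k. k div 2) E'"
  and over_subset: "over Y E E' \<Longrightarrow> E \<subseteq> E'"
  and over_new: "over Y E E' \<Longrightarrow> k \<in> E' \<Longrightarrow> k \<notin> E \<Longrightarrow> k div 2 \<in> Y"
  by (auto simp: over_def)

lemma over_refl: "finite E \<Longrightarrow> inj_on (\<lambda>k. k div 2) E \<Longrightarrow> over Y E E"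
  by (auto simp: over_def)

lemma over_mono: "over Y E E' \<Longrightarrow> Y \<subseteq> Y' \<Longrightarrow> over Y' E E'"
  by (auto simp: over_def)

lemma over_trans: "over Y E E' \<Longrightarrow> over Y E' E'' \<Longrightarrow> over Y E E''"
  unfolding over_def by blast

text \<open>Both codes of a number from \<open>n\<close> on are at least \<open>2 * n\<close>; hence
  the use bound \<open>2 * len q\<close> below.\<close>

lemma over_below: "over (Y \<inter> {n..}) E E' \<Longrightarrow> E' \<inter> {..<2 * n} = E \<inter> {..<2 * n}"
  unfolding over_def
proof (elim conjE, intro equalityI subsetI)
  fix k assume new: "\<forall>k\<in>E' - E. k div 2 \<in> Y \<inter> {n..}" and k: "k \<in> E' \<inter> {..<2 * n}"
  then have "\<not> n \<le> k div 2" by auto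
  then show "k \<in> E \<inter> {..<2 * n}" using new k by auto
qed auto

text \<open>Quantifying over all infinite subsets makes the property hereditary: it is kept when the
  reservoir is thinned, and by \<open>often_tail\<close> it ignores finite initial parts.\<close>

definition often :: "nat set \<Rightarrow> nat set \<Rightarrow> (nat set \<Rightarrow> bool) \<Rightarrow> bool" where
  "often Y E W \<longleftrightarrow> (\<forall>Y'. Y' \<subseteq> Y \<and> infinite Y' \<longrightarrow> (\<exists>E'. over Y' E E' \<and> W E'))"

lemma oftenD: "often Y E W \<Longrightarrow> Y' \<subseteq> Y \<Longrightarrow> infinite Y' \<Longrightarrow> \<exists>E'. over Y' E E' \<and> W E'"
  unfolding often_def by blast

lemma often_mono: "often Y E W \<Longrightarrow> Y' \<subseteq> Y \<Longrightarrow> often Y' E W"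
  unfolding often_def by blast

lemma infinite_tail: "infinite (Y :: nat set) \<Longrightarrow> infinite (Y \<inter> {n..})"
  by (metis Diff_Compl Compl_atLeast Diff_infinite_finite finite_lessThan)

lemma infinite_natD: "infinite (Y :: nat set) \<Longrightarrow> \<exists>x\<in>Y. n \<le> x"
  by (meson infinite_nat_iff_unbounded_le)

lemma often_tail:
  assumes "often Z E W" "Y \<inter> {n..} \<subseteq> Z"
  shows "often Y E W"
  unfolding often_def
proof (intro allI impI, elim conjE)
  fix Y' assume "Y' \<subseteq> Y" "infinite Y'"
  then have "Y' \<inter> {n..} \<subseteq> Z" "infinite (Y' \<inter> {n..})"
    using assms(2) infinite_tail by auto
  then obtain E' where "over (Y' \<inter> {n..}) E E'" "W E'"
    using oftenD[OF assms(1)] by blast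
  then show "\<exists>E'. over Y' E E' \<and> W E'" by (meson inf_le1 over_mono)
qed

text \<open>A diagonal intersection. Step \<open>n\<close> shrinks the set so that the
  \<open>n\<close>-th pair of an index and a stem either succeeds hereditarily or fails outright.
  The diagonal set lies in each \<open>Z n\<close> up to finitely many elements; success ignores
  these, and failure is claimed only on a tail.\<close>

lemma fusion:
  fixes W :: "'i::countable \<Rightarrow> nat set \<Rightarrow> bool"
  obtains X where "infinite X"
    "\<And>i E. finite E \<Longrightarrow> often X E (W i) \<or> (\<exists>n. \<forall>E'. over (X \<inter> {n..}) E E' \<longrightarrow> \<not> W i E')"
proof -
  define dec where "dec j Z \<longleftrightarrow> (case from_nat j :: 'i \<times> nat list of (i, l) \<Rightarrow>
      often Z (set l) (W i) \<or> (\<forall>E'. over Z (set l) E' \<longrightarrow> \<not> W i E'))" for j Z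
  have "\<exists>f. \<forall>n. infinite (f n) \<and> (f (Suc n) \<subseteq> f n \<and> dec n (f (Suc n)))"
  proof (rule dependent_nat_choice)
    show "\<exists>Z :: nat set. infinite Z" by auto
  next
    fix Z :: "nat set" and n :: nat assume Z: "infinite Z"
    obtain i l where il: "from_nat n = (i :: 'i, l :: nat list)" by fastforce
    show "\<exists>Z'. infinite Z' \<and> Z' \<subseteq> Z \<and> dec n Z'"
    proof (cases "often Z (set l) (W i)")
      case True
      then show ?thesis using Z il unfolding dec_def by auto
    next
      case False
      then show ?thesis using il unfolding dec_def often_def by auto
    qed
  qed
  then obtain Z where Z: "\<And>n. infinite (Z n)" "\<And>n. Z (Suc n) \<subseteq> Z n" "\<And>n. dec n (Z (Suc n))"
    by blast
  have dec: "antimono Z" using Z(2) by (simp add: antimono_iff_le_Suc)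
  have "\<exists>x. \<forall>n. x n \<in> Z n \<and> x n < x (Suc n)"
    by (rule dependent_nat_choice[where P = "\<lambda>n a. a \<in> Z n" and Q = "\<lambda>n a b. a < b"])
      (use infinite_natD[OF Z(1)] Suc_le_eq in blast)+
  then obtain x where x: "\<And>n. x n \<in> Z n" "strict_mono x"
    using strict_mono_Suc_iff by metis
  have tail: "range x \<inter> {x n..} \<subseteq> Z n" for n
  proof
    fix a assume "a \<in> range x \<inter> {x n..}"
    then obtain j where "a = x j" "n \<le> j" using x(2) by (auto simp: strict_mono_less_eq)
    then show "a \<in> Z n" using x(1)[of j] antimonoD[OF dec, of n j] by auto
  qed
  show thesis
  proof (rule that[of "range x"])
    show "infinite (range x)"
      using x(2) by (simp add: range_inj_infinite strict_mono_imp_inj_on)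
    fix i :: 'i and E :: "nat set" assume "finite E"
    then obtain l where l: "E = set l" using finite_list by blast
    define n where "n = to_nat (i, l)"
    have il: "from_nat n = (i, l)" by (simp add: n_def)
    from Z(3)[of n] consider "often (Z (Suc n)) E (W i)" | "\<forall>E'. over (Z (Suc n)) E E' \<longrightarrow> \<not> W i E'"
      unfolding dec_def il l by auto
    then show "often (range x) E (W i) \<or> (\<exists>n. \<forall>E'. over (range x \<inter> {n..}) E E' \<longrightarrow> \<not> W i E')"
    proof cases
      case 1
      then show ?thesis using often_tail tail by blast
    next
      case 2
      then show ?thesis using over_mono tail by blast
    qed
  qed
qed

lemma finite_subset_mono_Union:
  fixes S :: "nat \<Rightarrow> 'a set"
  assumes "mono S" "finite N" "N \<subseteq> \<Union> (range S)"
  shows "\<exists>n. N \<subseteq> S n"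
  using assms(2,3)
proof (induction N rule: finite_induct)
  case (insert a N)
  then obtain n m where nm: "N \<subseteq> S n" "a \<in> S m" by auto
  have "S n \<subseteq> S (max n m)" "S m \<subseteq> S (max n m)" by (simp_all add: monoD[OF assms(1)])
  then have "insert a N \<subseteq> S (max n m)" using nm by blast
  then show ?case ..
qed simp

text \<open>Only finitely many sets of codes lie below a given bound, so each new element can be
  taken beyond \<open>T\<close> of all sets formed from earlier ones.\<close>

lemma infinite_thin:
  fixes T :: "nat set \<Rightarrow> nat"
  assumes "infinite Y"
  obtains Y' where "Y' \<subseteq> Y" "infinite Y'"
    "\<And>E x. x \<in> Y' \<Longrightarrow> E \<subseteq> {..<2 * m} \<union> {k. k div 2 \<in> Y' \<and> k div 2 < x} \<Longrightarrow> T E \<le> x"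
proof -
  define K where "K j = Max (T ` Pow {..<2 * j})" for j
  have K: "T E \<le> K j" if "E \<subseteq> {..<2 * j}" for E j
    unfolding K_def using that by (intro Max_ge) auto
  have "\<exists>f. \<forall>n. (f n \<in> Y \<and> K m \<le> f n) \<and> (f n < f (Suc n) \<and> K (max m (Suc (f n))) \<le> f (Suc n))"
  proof (rule dependent_nat_choice)
    show "\<exists>x. x \<in> Y \<and> K m \<le> x" using infinite_natD[OF assms] by blast
  next
    fix x n
    show "\<exists>y. (y \<in> Y \<and> K m \<le> y) \<and> x < y \<and> K (max m (Suc x)) \<le> y"
      using infinite_natD[OF assms, of "max (K m) (max (Suc x) (K (max m (Suc x))))"] by auto
  qed
  then obtain f where f: "\<And>n. f n \<in> Y" "\<And>n. K m \<le> f n" "\<And>n. f n < f (Suc n)"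
    "\<And>n. K (max m (Suc (f n))) \<le> f (Suc n)" by blast
  have mono: "strict_mono f" using f(3) by (simp add: strict_mono_Suc_iff)
  show thesis
  proof (rule that[of "range f"])
    show "range f \<subseteq> Y" using f(1) by blast
    show "infinite (range f)" using mono by (simp add: range_inj_infinite strict_mono_imp_inj_on)
    fix E x assume "x \<in> range f" and E: "E \<subseteq> {..<2 * m} \<union> {k. k div 2 \<in> range f \<and> k div 2 < x}"
    then obtain n where n: "x = f n" by blast
    show "T E \<le> x"
    proof (cases n)
      case 0
      have "E \<subseteq> {..<2 * m}" using E n 0 strict_mono_less[OF mono] by auto
      then show ?thesis using K f(2) n order_trans by blast
    next
      case (Suc i)
      have "k < 2 * max m (Suc (f i))" if "k \<in> E" for k
      proof -
        have "k < 2 * m \<or> (k div 2 \<in> range f \<and> k div 2 < f n)" using E n that by auto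
        then consider "k < 2 * m" | j where "k div 2 = f j" "f j < f n" by (metis rangeE)
        then show ?thesis
        proof cases
          case 2
          then have "j \<le> i" using strict_mono_less[OF mono] Suc by auto
          then have "k div 2 < Suc (f i)" using strict_mono_less_eq[OF mono, of j i] 2(1) by linarith
          then have "k < 2 * Suc (f i)" by (simp only: div2_less_iff)
          also have "\<dots> \<le> 2 * max m (Suc (f i))" by (intro mult_le_mono2 max.cobounded2)
          finally show ?thesis .
        qed (simp add: less_max_iff_disj nat_mult_max_right)
      qed
      then have "T E \<le> K (max m (Suc (f i)))" by (intro K) auto
      then show ?thesis using f(4)[of i] n Suc by auto
    qed
  qed
qed

subsection \<open>Conditions\<close>

text \<open>A condition fixes the colors of all pairs below \<open>len\<close> and promises a limit color for each
  number below \<open>len\<close>; later colors of such a number agree with its promised limit.\<close>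

datatype cond = Cond (len: nat) (pt: "nat \<Rightarrow> nat \<Rightarrow> bool") (lm: "nat \<Rightarrow> bool")

definition below :: "cond \<Rightarrow> cond \<Rightarrow> bool" (infix "\<sqsubseteq>" 50) where
  "q \<sqsubseteq> p \<longleftrightarrow> len p \<le> len q
     \<and> (\<forall>x y. x < y \<and> y < len p \<longrightarrow> pt q x y = pt p x y)
     \<and> (\<forall>x<len p. lm q x = lm p x)
     \<and> (\<forall>x y. x < len p \<and> len p \<le> y \<and> y < len q \<longrightarrow> pt q x y = lm p x)"

lemma below_refl [simp]: "q \<sqsubseteq> q"
  by (auto simp: below_def)

lemma below_len: "q \<sqsubseteq> p \<Longrightarrow> len p \<le> len q"
  by (simp add: below_def)

lemma below_pt: "q \<sqsubseteq> p \<Longrightarrow> x < y \<Longrightarrow> y < len p \<Longrightarrow> pt q x y = pt p x y"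
  by (simp add: below_def)

lemma below_lm: "q \<sqsubseteq> p \<Longrightarrow> x < len p \<Longrightarrow> lm q x = lm p x"
  by (simp add: below_def)

lemma below_pt_lm: "q \<sqsubseteq> p \<Longrightarrow> x < len p \<Longrightarrow> len p \<le> y \<Longrightarrow> y < len q \<Longrightarrow> pt q x y = lm p x"
  by (simp add: below_def)

lemma below_trans [trans]:
  assumes "r \<sqsubseteq> q" "q \<sqsubseteq> p"
  shows "r \<sqsubseteq> p"
  unfolding below_def
proof (intro conjI allI impI)
  show "len p \<le> len r" using assms below_len order_trans by blast
next
  fix x y assume "x < y \<and> y < len p"
  then show "pt r x y = pt p x y"
    using assms below_len[OF assms(2)] by (simp add: below_pt)
next
  fix x assume "x < len p"
  then show "lm r x = lm p x" using assms below_len[OF assms(2)] by (simp add: below_lm)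
next
  fix x y assume *: "x < len p \<and> len p \<le> y \<and> y < len r"
  show "pt r x y = lm p x"
  proof (cases "y < len q")
    case True
    then have "pt r x y = pt q x y" using * by (intro below_pt[OF assms(1)]) auto
    then show ?thesis using below_pt_lm[OF assms(2)] * True by simp
  next
    case False
    then have "pt r x y = lm q x"
      using * below_len[OF assms(2)] by (intro below_pt_lm[OF assms(1)]) auto
    then show ?thesis using below_lm[OF assms(2)] * by simp
  qed
qed

text \<open>New colors follow the promised limits. Limits from \<open>len q\<close> on are not yet
  promised, so \<open>v\<close> may prescribe them freely; wrong promises made on purpose come from
  here or from \<open>flip\<close>.\<close>

lemma lengthen:
  obtains r where "r \<sqsubseteq> q" "N \<le> len r" "\<And>z. len q \<le> z \<Longrightarrow> lm r z = v z"
proof (rule that)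
  let ?r = "Cond (max N (len q)) (\<lambda>x y. if y < len q then pt q x y else lm q x)
    (\<lambda>z. if z < len q then lm q z else v z)"
  show "?r \<sqsubseteq> q" "N \<le> len ?r" "\<And>z. len q \<le> z \<Longrightarrow> lm ?r z = v z"
    by (auto simp: below_def)
qed

text \<open>The value of a promised limit may be revised as long as it was not promised by \<open>p\<close>.\<close>

definition flip :: "cond \<Rightarrow> nat \<Rightarrow> bool \<Rightarrow> cond" where
  "flip q z v = Cond (len q) (pt q) ((lm q)(z := v))"

lemma flip_simps [simp]:
  "len (flip q z v) = len q" "pt (flip q z v) = pt q" "lm (flip q z v) = (lm q)(z := v)"
  by (simp_all add: flip_def)

lemma flip_below: "q \<sqsubseteq> p \<Longrightarrow> len p \<le> z \<Longrightarrow> flip q z v \<sqsubseteq> p"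
  by (auto simp: below_def)

subsection \<open>Forcing facts about a computed coloring\<close>

text \<open>Only \<open>pt q\<close> enters here, so that decided values survive a revision of limits by \<open>flip\<close>.\<close>

definition decides :: "recf \<Rightarrow> cond \<Rightarrow> nat \<Rightarrow> nat \<Rightarrow> bool \<Rightarrow> bool" where
  "decides e q x y c \<longleftrightarrow> (\<forall>f. (\<forall>a b. a < b \<and> b < len q \<longrightarrow> f a b = pt q a b)
     \<longrightarrow> eval (code f) e [prod_encode (x, y)] (of_bool c))"

text \<open>The limit is forced negatively: with \<open>len q\<close> as threshold, no extension can
  produce the other color. Totality later turns this into positive decisions.\<close>

definition lims :: "recf \<Rightarrow> cond \<Rightarrow> nat \<Rightarrow> bool \<Rightarrow> bool" where
  "lims e q x c \<longleftrightarrow> x < len q \<and> (\<forall>r y. r \<sqsubseteq> q \<and> len q \<le> y \<longrightarrow> \<not> decides e r x y (\<not> c))"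

definition total :: "recf \<Rightarrow> cond \<Rightarrow> bool" where
  "total e q \<longleftrightarrow> (\<forall>r x y. r \<sqsubseteq> q \<and> x < y \<longrightarrow> (\<exists>r'. r' \<sqsubseteq> r \<and> (\<exists>c. decides e r' x y c)))"

definition settles :: "recf \<Rightarrow> cond \<Rightarrow> bool" where
  "settles e q \<longleftrightarrow> (\<forall>r x. r \<sqsubseteq> q \<longrightarrow> (\<exists>r'. r' \<sqsubseteq> r \<and> (\<exists>c. lims e r' x c)))"

text \<open>A stem for a p-homogeneous set of color \<open>c\<close>: only pairs from opposite sides
  are constrained, and the limits \<open>c\<close> keep it extendible by late elements of limit
  \<open>c\<close>.\<close>

definition good :: "recf \<Rightarrow> bool \<Rightarrow> cond \<Rightarrow> nat set \<Rightarrow> bool" where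
  "good e c q E \<longleftrightarrow> finite E \<and> inj_on (\<lambda>k. k div 2) E \<and> E \<subseteq> {..<2 * len q}
     \<and> (\<forall>k\<in>E. lims e q (k div 2) c)
     \<and> (\<forall>j\<in>E. \<forall>k\<in>E. j < k \<and> odd j \<noteq> odd k \<longrightarrow> decides e q (j div 2) (k div 2) c)"

lemma decides_cong:
  "len r = len q \<Longrightarrow> pt r = pt q \<Longrightarrow> decides e r = decides e q"
  by (simp add: decides_def fun_eq_iff)

lemma decides_mono: "decides e q x y c \<Longrightarrow> r \<sqsubseteq> q \<Longrightarrow> decides e r x y c"
  unfolding decides_def using below_len[of r q] below_pt[of r q] by auto

lemma lims_len: "lims e q x c \<Longrightarrow> x < len q"
  by (simp add: lims_def)

lemma lims_mono: "lims e q x c \<Longrightarrow> r \<sqsubseteq> q \<Longrightarrow> lims e r x c"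
  unfolding lims_def by (meson below_len below_trans less_le_trans order_trans)

lemma good_finite: "good e c q E \<Longrightarrow> finite E"
  and good_inj: "good e c q E \<Longrightarrow> inj_on (\<lambda>k. k div 2) E"
  and good_less: "good e c q E \<Longrightarrow> k \<in> E \<Longrightarrow> k < 2 * len q"
  and good_lims: "good e c q E \<Longrightarrow> k \<in> E \<Longrightarrow> lims e q (k div 2) c"
  and good_decides: "good e c q E \<Longrightarrow> j \<in> E \<Longrightarrow> k \<in> E \<Longrightarrow> j < k \<Longrightarrow> odd j \<noteq> odd k
    \<Longrightarrow> decides e q (j div 2) (k div 2) c"
  by (auto simp: good_def)

lemma good_mono: "good e c q E \<Longrightarrow> r \<sqsubseteq> q \<Longrightarrow> good e c r E"
  unfolding good_def using decides_mono[of e q _ _ c r] lims_mono[of e q _ c r] below_len[of r q] by auto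

lemma good_empty [simp]: "good e c q {}"
  by (simp add: good_def)

lemma total_mono: "total e q \<Longrightarrow> r \<sqsubseteq> q \<Longrightarrow> total e r"
  unfolding total_def by (meson below_trans)

lemma settles_mono: "settles e q \<Longrightarrow> r \<sqsubseteq> q \<Longrightarrow> settles e r"
  unfolding settles_def by (meson below_trans)

section \<open>Outputs of functionals and the ways to defeat them\<close>

definition prints :: "recf \<Rightarrow> nat \<Rightarrow> nat set \<Rightarrow> bool" where
  "prints \<psi> w E \<longleftrightarrow> eval (chi E) \<psi> [w] 1"

definition prints_from :: "recf \<Rightarrow> nat \<Rightarrow> nat set \<Rightarrow> bool" where
  "prints_from \<psi> n E \<longleftrightarrow> (\<exists>w\<ge>n. prints \<psi> w E)"

lemma computes_prints: "computes \<psi> m E w \<Longrightarrow> prints \<psi> w E"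
  unfolding prints_def by (rule computes_eval) auto

lemma computes_over:
  assumes "computes \<psi> (2 * len q) E w" "over (Y \<inter> {len q..}) E E'" "len q \<le> len r"
  shows "computes \<psi> (2 * len r) E' w"
  using assms(1) by (rule computes_mono) (use assms(2,3) over_below in auto)

lemma prints_computes:
  assumes "prints \<psi> w E"
  obtains m where "\<And>n. m \<le> n \<Longrightarrow> computes \<psi> n E w"
  using assms unfolding prints_def by (metis computes_mono eval_computes)

text \<open>The first disjunct defeats \<open>\<psi>\<close> by an inhomogeneous output, the second by a finite one.\<close>

definition win :: "nat set \<Rightarrow> recf \<Rightarrow> cond \<Rightarrow> nat set \<Rightarrow> bool" where
  "win X \<psi> q E \<longleftrightarrow>
     (\<exists>a b a' b'. a < b \<and> b < len q \<and> a' < b' \<and> b' < len q \<and> pt q a b \<noteq> pt q a' b'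
        \<and> (\<forall>w\<in>{a, b, a', b'}. computes \<psi> (2 * len q) E w))
     \<or> (\<exists>n. \<forall>E'. over (X \<inter> {len q..}) E E' \<longrightarrow> \<not> prints_from \<psi> n E')"

definition reservoir :: "nat set \<Rightarrow> bool" where
  "reservoir X \<longleftrightarrow> infinite X \<and> (\<forall>\<psi> n E. \<forall>W\<in>{prints \<psi> n, prints_from \<psi> n}. finite E \<longrightarrow>
     often X E W \<or> (\<exists>m. \<forall>E'. over (X \<inter> {m..}) E E' \<longrightarrow> \<not> W E'))"

lemma reservoir_exists: "\<exists>X. reservoir X"
proof -
  define W :: "recf \<times> nat \<times> bool \<Rightarrow> nat set \<Rightarrow> bool" where
    "W = (\<lambda>(\<psi>, n, b). if b then prints \<psi> n else prints_from \<psi> n)"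
  obtain X where "infinite X" and X: "\<And>i E. finite E \<Longrightarrow> often X E (W i) \<or>
      (\<exists>n. \<forall>E'. over (X \<inter> {n..}) E E' \<longrightarrow> \<not> W i E')" using fusion[of W] by metis
  have "reservoir X"
    unfolding reservoir_def
  proof (intro conjI allI ballI impI \<open>infinite X\<close>)
    fix \<psi> n V and E :: "nat set" assume "V \<in> {prints \<psi> n, prints_from \<psi> n}" "finite E"
    then have "\<exists>b. V = W (\<psi>, n, b)"
      by (auto simp: W_def intro: exI[of _ True] exI[of _ False])
    then show "often X E V \<or> (\<exists>m. \<forall>E'. over (X \<inter> {m..}) E E' \<longrightarrow> \<not> V E')"
      using X[OF \<open>finite E\<close>] by blast
  qed
  then show ?thesis ..
qed

section \<open>Building stems of one color\<close>

locale forcing =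
  fixes e :: recf and X :: "nat set" and P :: cond
  assumes res: "reservoir X" and tot: "total e P" and set: "settles e P"
begin

lemma decide: "r \<sqsubseteq> P \<Longrightarrow> x < y \<Longrightarrow> \<exists>r'. r' \<sqsubseteq> r \<and> (\<exists>c. decides e r' x y c)"
  using tot unfolding total_def by blast

lemma settle: "r \<sqsubseteq> P \<Longrightarrow> \<exists>r'. r' \<sqsubseteq> r \<and> (\<exists>c. lims e r' x c)"
  using set unfolding settles_def by blast

text \<open>Totality decides the pair, and the forced limit excludes the other color because
  \<open>x\<close> is not below \<open>len q\<close>.\<close>

lemma lims_decides1:
  assumes "r \<sqsubseteq> P" "lims e q y c" "r \<sqsubseteq> q" "len q \<le> x"
  obtains r' where "r' \<sqsubseteq> r" "decides e r' y x c"
proof -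
  have "y < x" using lims_len[OF assms(2)] assms(4) by simp
  then obtain r' c' where r': "r' \<sqsubseteq> r" "decides e r' y x c'" using decide assms(1) by blast
  have "r' \<sqsubseteq> q" using r'(1) assms(3) by (rule below_trans)
  then have "\<not> decides e r' y x (\<not> c)" using assms(2,4) unfolding lims_def by blast
  then have "c' = c" using r'(2) by (cases c; cases c') auto
  then show thesis using r' that by blast
qed

lemma lims_decides:
  assumes "finite S" "\<forall>y\<in>S. lims e q y c" "r \<sqsubseteq> q" "len q \<le> x" "q \<sqsubseteq> P"
  shows "\<exists>r'. r' \<sqsubseteq> r \<and> (\<forall>y\<in>S. decides e r' y x c)"
  using assms(1,2)
proof (induction S rule: finite_induct)
  case empty
  then show ?case using below_refl by blast
next
  case (insert y S)
  then obtain r' where r': "r' \<sqsubseteq> r" "\<forall>y\<in>S. decides e r' y x c" by auto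
  have "r' \<sqsubseteq> q" using r'(1) assms(3) by (rule below_trans)
  moreover from this have "r' \<sqsubseteq> P" using assms(5) by (rule below_trans)
  ultimately obtain r'' where r'': "r'' \<sqsubseteq> r'" "decides e r'' y x c"
    using lims_decides1[of r' q y c x] insert.prems assms(4) by blast
  have "\<forall>y\<in>S. decides e r'' y x c" using r'(2) r''(1) decides_mono by blast
  then show ?case using r'' below_trans[OF r''(1) r'(1)] by auto
qed

text \<open>Pairs with old elements get color \<open>c\<close> through the limits of those, so the
  new element needs only its own limit and may join either side.\<close>

lemma good_insert:
  assumes "q \<sqsubseteq> P" "good e c q E" "r \<sqsubseteq> q" "len q \<le> x" "lims e r x c"
  shows "\<exists>r'. r' \<sqsubseteq> r \<and> good e c r' (insert (tag s x) E)"
proof -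
  have "\<exists>r'. r' \<sqsubseteq> r \<and> (\<forall>y\<in>(\<lambda>k. k div 2) ` E. decides e r' y x c)"
  proof (rule lims_decides[OF _ _ assms(3,4,1)])
    show "finite ((\<lambda>k. k div 2) ` E)" using good_finite[OF assms(2)] by simp
    show "\<forall>y\<in>(\<lambda>k. k div 2) ` E. lims e q y c" using good_lims[OF assms(2)] by blast
  qed
  then obtain r' where r': "r' \<sqsubseteq> r" "\<And>k. k \<in> E \<Longrightarrow> decides e r' (k div 2) x c" by blast
  have E: "good e c r' E" by (meson assms(2,3) below_trans good_mono r'(1))
  have lx: "lims e r' x c" using assms(5) r'(1) lims_mono by blast
  have small: "k < tag s x \<and> k div 2 < x" if "k \<in> E" for k
  proof -
    have "k < 2 * x" using good_less[OF assms(2) that] assms(4) by simp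
    then show ?thesis using tag_ge(2)[of x s] by auto
  qed
  have "good e c r' (insert (tag s x) E)"
    unfolding good_def
  proof (intro conjI)
    show "inj_on (\<lambda>k. k div 2) (insert (tag s x) E)"
      using good_inj[OF E] small by (auto simp: inj_on_def)
    show "insert (tag s x) E \<subseteq> {..<2 * len r'}"
      using good_less[OF E] lims_len[OF lx] by (auto simp: tag_def)
    show "\<forall>k\<in>insert (tag s x) E. lims e r' (k div 2) c"
      using good_lims[OF E] lx by auto
    show "\<forall>j\<in>insert (tag s x) E. \<forall>k\<in>insert (tag s x) E. j < k \<and> odd j \<noteq> odd k
        \<longrightarrow> decides e r' (j div 2) (k div 2) c"
    proof (intro ballI impI)
      fix j k assume *: "j \<in> insert (tag s x) E" "k \<in> insert (tag s x) E" "j < k \<and> odd j \<noteq> odd k"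
      then have "j \<in> E" using small by (metis insertE less_asym less_irrefl)
      then show "decides e r' (j div 2) (k div 2) c"
        using *(2,3) r'(2) good_decides[OF E, of j k] by auto
    qed
  qed (use good_finite[OF E] in simp)
  then show ?thesis using r'(1) by blast
qed

text \<open>The supply of elements for color \<open>c\<close>: no extension of \<open>q\<close> can
  exclude the limit \<open>c\<close> on a tail of \<open>Y\<close>. Its failure is the first way to
  be stuck.\<close>

definition rich :: "bool \<Rightarrow> cond \<Rightarrow> nat set \<Rightarrow> bool" where
  "rich c q Y \<longleftrightarrow> (\<forall>r N. r \<sqsubseteq> q \<longrightarrow> (\<exists>r' x. r' \<sqsubseteq> r \<and> x \<in> Y \<and> N \<le> x \<and> lims e r' x c))"

lemma rich_mono: "rich c q Y \<Longrightarrow> r \<sqsubseteq> q \<Longrightarrow> rich c r Y"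
  unfolding rich_def by (auto dest: below_trans)

text \<open>Elements of limit \<open>c\<close> are added one after another along a descending
  sequence of conditions. No condition need lie below the whole sequence, since a finite
  \<open>E'\<close> lies inside one stage; and \<open>Z\<close>, being infinite, is a set to which
  \<open>often\<close> applies.\<close>

lemma homogeneous_reservoir:
  assumes q: "q \<sqsubseteq> P" "good e c q E" and "rich c q Y"
  obtains Z where "Z \<subseteq> Y \<inter> {len q..}" "infinite Z"
    "\<And>E'. over Z E E' \<Longrightarrow> \<exists>r. r \<sqsubseteq> q \<and> good e c r E'"
proof -
  define S0 where "S0 = (\<lambda>k. k div 2) ` E"
  \<comment> \<open>Pairs whose larger member comes from \<open>E\<close> are exempt: those are
    covered by \<open>good e c q E\<close>.\<close>
  define inv where "inv r S \<longleftrightarrow> r \<sqsubseteq> q \<and> finite S \<and> S0 \<subseteq> S \<and> (\<forall>x\<in>S. lims e r x c)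
    \<and> S - S0 \<subseteq> Y \<inter> {len q..} \<and> (\<forall>y\<in>S. \<forall>x\<in>S. y < x \<longrightarrow> x \<in> S0 \<or> decides e r y x c)" for r S
  have "\<exists>h. \<forall>n. (case h n of (r, S) \<Rightarrow> inv r S) \<and> snd (h n) \<subset> snd (h (Suc n))"
  proof (rule dependent_nat_choice)
    have "inv q S0"
      using good_finite[OF q(2)] good_lims[OF q(2)] by (auto simp: inv_def S0_def)
    then show "\<exists>h. case h of (r, S) \<Rightarrow> inv r S" by blast
  next
    fix h :: "cond \<times> nat set" and n :: nat
    assume "case h of (r, S) \<Rightarrow> inv r S"
    then obtain r S where h: "h = (r, S)" and rS: "inv r S" by (cases h) auto
    have "r \<sqsubseteq> q" using rS by (simp add: inv_def)
    note rq = this below_trans[OF this q(1)]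
    obtain r1 x where x: "r1 \<sqsubseteq> r" "x \<in> Y" "len r \<le> x" "lims e r1 x c"
      using assms(3) rq(1) unfolding rich_def by blast
    have S: "finite S" "\<forall>y\<in>S. lims e r y c" using rS by (auto simp: inv_def)
    obtain r2 where r2: "r2 \<sqsubseteq> r1" "\<forall>y\<in>S. decides e r2 y x c"
      using lims_decides[OF S x(1,3) rq(2)] by blast
    have r2r: "r2 \<sqsubseteq> r" using r2(1) x(1) by (rule below_trans)
    have less: "y < x" if "y \<in> S" for y
      using that S(2) lims_len x(3) by fastforce
    have "inv r2 (insert x S)"
      unfolding inv_def
    proof (intro conjI)
      show "r2 \<sqsubseteq> q" using r2r rq(1) by (rule below_trans)
      show "\<forall>x\<in>insert x S. lims e r2 x c" using S(2) r2r r2(1) x(4) lims_mono by blast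
      show "insert x S - S0 \<subseteq> Y \<inter> {len q..}"
        using rS x(2,3) below_len[OF rq(1)] by (auto simp: inv_def)
      show "\<forall>y\<in>insert x S. \<forall>z\<in>insert x S. y < z \<longrightarrow> z \<in> S0 \<or> decides e r2 y z c"
      proof (intro ballI impI)
        fix y z assume yz: "y \<in> insert x S" "z \<in> insert x S" "y < z"
        then have "y \<in> S" using less by (metis insertE less_asym less_irrefl)
        then show "z \<in> S0 \<or> decides e r2 y z c"
          using yz r2(2) rS decides_mono[OF _ r2r] unfolding inv_def by (metis insertE)
      qed
    qed (use rS in \<open>auto simp: inv_def\<close>)
    moreover have "S \<subset> insert x S" using less by blast
    ultimately have "(case (r2, insert x S) of (r, S) \<Rightarrow> inv r S) \<and> snd h \<subset> snd (r2, insert x S)"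
      unfolding h prod.case snd_conv by (rule conjI)
    then show "\<exists>h'. (case h' of (r, S) \<Rightarrow> inv r S) \<and> snd h \<subset> snd h'" by (rule exI)
  qed
  then obtain h where h: "\<forall>n. (case h n of (r, S) \<Rightarrow> inv r S) \<and> snd (h n) \<subset> snd (h (Suc n))" ..
  define R S where "R n = fst (h n)" and "S n = snd (h n)" for n
  have inv: "inv (R n) (S n)" and S_Suc: "S n \<subset> S (Suc n)" for n
    using h[rule_format, of n] unfolding R_def S_def by (simp_all add: case_prod_beta)
  have Rq: "R n \<sqsubseteq> q" and finS: "finite (S n)" and S0: "S0 \<subseteq> S n"
    and limS: "\<And>x. x \<in> S n \<Longrightarrow> lims e (R n) x c" and newS: "S n - S0 \<subseteq> Y \<inter> {len q..}"
    and decS: "\<And>x y. y \<in> S n \<Longrightarrow> x \<in> S n \<Longrightarrow> y < x \<Longrightarrow> x \<notin> S0 \<Longrightarrow> decides e (R n) y x c" for n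
    using inv[of n] unfolding inv_def by blast+
  have S_mono: "mono S" using S_Suc by (simp add: mono_iff_le_Suc psubset_imp_subset)
  have card: "n \<le> card (S n)" for n
  proof (induction n)
    case (Suc n)
    have "card (S n) < card (S (Suc n))" by (rule psubset_card_mono[OF finS S_Suc])
    then show ?case using Suc by simp
  qed simp
  define Z where "Z = \<Union> (range S) - S0"
  show thesis
  proof (rule that)
    show ZY: "Z \<subseteq> Y \<inter> {len q..}" using newS unfolding Z_def by blast
    show "infinite Z"
    proof
      assume "finite Z"
      moreover have "finite S0" using good_finite[OF q(2)] by (simp add: S0_def)
      ultimately have fin: "finite (\<Union> (range S))" by (simp add: Z_def)
      have "card (S n) \<le> card (\<Union> (range S))" for n
        by (intro card_mono fin) blast
      then show False using card[of "Suc (card (\<Union> (range S)))"] by (meson Suc_n_not_le_n order_trans)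
    qed
    fix E' assume E': "over Z E E'"
    let ?N = "(\<lambda>k. k div 2) ` E'"
    have "?N \<subseteq> Z \<union> S0" using over_new[OF E'] unfolding S0_def by blast
    also have "\<dots> \<subseteq> \<Union> (range S)" using S0 unfolding Z_def by blast
    finally have "\<exists>n. ?N \<subseteq> S n"
      using over_finite[OF E'] by (intro finite_subset_mono_Union[OF S_mono]) simp_all
    then obtain n where n: "?N \<subseteq> S n" by blast
    have "good e c (R n) E'"
      unfolding good_def
    proof (intro conjI)
      show "finite E'" "inj_on (\<lambda>k. k div 2) E'" using over_finite[OF E'] over_inj[OF E'] by auto
      show lims: "\<forall>k\<in>E'. lims e (R n) (k div 2) c" using n limS by blast
      then show "E' \<subseteq> {..<2 * len (R n)}" using lims_len div2_less_iff by blast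
      show "\<forall>j\<in>E'. \<forall>k\<in>E'. j < k \<and> odd j \<noteq> odd k \<longrightarrow> decides e (R n) (j div 2) (k div 2) c"
      proof (intro ballI impI)
        fix j k assume j: "j \<in> E'" and k: "k \<in> E'" and jk: "j < k \<and> odd j \<noteq> odd k"
        have lt: "j div 2 < k div 2" using inj_div2_less[OF over_inj[OF E'] j k] jk by blast
        show "decides e (R n) (j div 2) (k div 2) c"
        \<comment> \<open>New numbers are at least \<open>len q\<close>, so below an old
          \<open>k\<close> there are only old \<open>j\<close>.\<close>
        proof (cases "k \<in> E")
          case True
          then have "k < 2 * len q" using good_less[OF q(2)] by blast
          then have "\<not> len q \<le> j div 2" using jk by linarith
          then have "j \<in> E" using over_new[OF E' j] ZY by auto
          then show ?thesis using good_decides[OF q(2) _ True] jk decides_mono[OF _ Rq] by blast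
        next
          case False
          then have "k div 2 \<notin> S0" using over_new[OF E' k] by (simp add: Z_def)
          then show ?thesis using decS[OF _ _ lt] n j k by blast
        qed
      qed
    qed
    then show "\<exists>r. r \<sqsubseteq> q \<and> good e c r E'" using Rq by blast
  qed
qed

lemma realize:
  assumes "q \<sqsubseteq> P" "good e c q E" "rich c q Y" "often Y E W"
  obtains r E' where "r \<sqsubseteq> q" "good e c r E'" "over (Y \<inter> {len q..}) E E'" "W E'"
proof -
  obtain Z where Z: "Z \<subseteq> Y \<inter> {len q..}" "infinite Z"
    "\<And>E'. over Z E E' \<Longrightarrow> \<exists>r. r \<sqsubseteq> q \<and> good e c r E'"
    using homogeneous_reservoir[OF assms(1-3)] by blast
  then obtain E' where "over Z E E'" "W E'" using oftenD[OF assms(4)] by blast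
  then show thesis using Z that over_mono by blast
qed

end

subsection \<open>Requirements and stuck colors\<close>

text \<open>There are two kinds of requirements: \<open>Inl\<close> asks for the defeat of a
  functional, \<open>Inr\<close> for a large element on one side, which makes both sides of the
  solution infinite.\<close>

definition meets :: "nat set \<Rightarrow> recf + nat \<times> bool \<Rightarrow> cond \<Rightarrow> nat set \<Rightarrow> bool" where
  "meets X t q E \<longleftrightarrow> (case t of Inl \<psi> \<Rightarrow> win X \<psi> q E | Inr (N, s) \<Rightarrow> \<exists>k\<in>E. N \<le> k \<and> odd k = s)"

definition dens :: "recf \<Rightarrow> nat set \<Rightarrow> bool \<Rightarrow> cond \<Rightarrow> bool" where
  "dens e X c q \<longleftrightarrow> (\<forall>t r E. r \<sqsubseteq> q \<and> good e c r E \<longrightarrow>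
     (\<exists>r' E'. r' \<sqsubseteq> r \<and> over (X \<inter> {len r..}) E E' \<and> good e c r' E' \<and> meets X t r' E'))"

lemma over_step:
  assumes "over (Y \<inter> {m..}) E E'" "over (Y' \<inter> {n..}) E' E''" "Y' \<subseteq> Y" "m \<le> n"
  shows "over (Y \<inter> {m..}) E E''"
  using assms(1) by (rule over_trans) (rule over_mono[OF assms(2)], use assms(3,4) in auto)

lemma over_insert: "inj_on (\<lambda>k. k div 2) (insert (tag s x) E) \<Longrightarrow> finite E \<Longrightarrow> x \<in> Y
    \<Longrightarrow> over Y E (insert (tag s x) E)"
  unfolding over_def by auto

lemma over_insertD: "over Y (insert (tag s x) E) E' \<Longrightarrow> x \<in> Y \<Longrightarrow> over Y E E'"
  unfolding over_def by (metis insert_iff insert_subset tag_simps(1) DiffE DiffI)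

lemma winI:
  assumes "a < b" "b < len q" "a' < b'" "b' < len q" "pt q a b \<noteq> pt q a' b'"
    "\<And>w. w \<in> {a, b, a', b'} \<Longrightarrow> computes \<psi> (2 * len q) E w"
  shows "win X \<psi> q E"
  unfolding win_def using assms by blast

lemma reservoir_refuses:
  assumes "reservoir X" "finite E" "W = prints \<psi> n \<or> W = prints_from \<psi> n" "\<not> often X E W"
  obtains m where "\<And>E'. over (X \<inter> {m..}) E E' \<Longrightarrow> \<not> W E'"
proof -
  have "W \<in> {prints \<psi> n, prints_from \<psi> n}" using assms(3) by blast
  then have "often X E W \<or> (\<exists>m. \<forall>E'. over (X \<inter> {m..}) E E' \<longrightarrow> \<not> W E')"
    using conjunct2[OF assms(1)[unfolded reservoir_def]] assms(2) by (metis (no_types))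
  then show thesis using assms(4) that by blast
qed

lemma infinite_inj_subset:
  assumes "infinite B" "\<And>v. finite {x \<in> B. f x = v}"
  obtains B' where "B' \<subseteq> B" "infinite B'" "inj_on f B'"
proof -
  have "infinite (f ` B)" using pigeonhole_infinite[OF assms(1)] assms(2) by blast
  moreover obtain B' where "B' \<subseteq> B" "inj_on f B'" "f ` B = f ` B'"
    using subset_image_inj[of "f ` B" f B] by blast
  ultimately show thesis using that by (metis finite_imageI)
qed

lemma infinite_trim:
  fixes z :: "nat \<Rightarrow> nat"
  assumes "infinite Y" "inj_on z Y"
  shows "infinite {x \<in> Y. n \<le> x \<and> n \<le> z x}"
proof
  assume fin: "finite {x \<in> Y. n \<le> x \<and> n \<le> z x}"
  have "finite (z -` {..<n} \<inter> Y)" using assms(2) by (intro finite_vimage_IntI) auto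
  moreover have "Y \<subseteq> {x \<in> Y. n \<le> x \<and> n \<le> z x} \<union> {..<n} \<union> (z -` {..<n} \<inter> Y)" by auto
  ultimately have "finite Y" using fin by (meson finite_Un finite_lessThan finite_subset)
  then show False using assms(1) by blast
qed

section \<open>Colors for which some functional cannot be defeated\<close>

context forcing
begin

text \<open>What remains of a stuck color: \<open>\<psi>\<close> can always print more, and its
  outputs from \<open>len q\<close> on look homogeneous of color \<open>d\<close>, both in the
  colors already fixed and in the promised limits.\<close>

definition anchored :: "recf \<Rightarrow> bool \<Rightarrow> bool \<Rightarrow> cond \<Rightarrow> nat set \<Rightarrow> bool" where
  "anchored \<psi> c d q E \<longleftrightarrow> q \<sqsubseteq> P \<and> good e c q E \<and>
     (\<forall>r E'. r \<sqsubseteq> q \<and> over (X \<inter> {len q..}) E E' \<and> good e c r E' \<longrightarrow>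
        (\<forall>n. often X E' (prints_from \<psi> n))
        \<and> (\<forall>w. len q \<le> w \<and> w < len r \<and> computes \<psi> (2 * len r) E' w \<longrightarrow> lm r w = d)
        \<and> (\<forall>v w. len q \<le> v \<and> v < w \<and> w < len r \<and> computes \<psi> (2 * len r) E' v
              \<and> computes \<psi> (2 * len r) E' w \<longrightarrow> pt r v w = d))"

lemma anchored_P: "anchored \<psi> c d q E \<Longrightarrow> q \<sqsubseteq> P"
  and anchored_good: "anchored \<psi> c d q E \<Longrightarrow> good e c q E"
  unfolding anchored_def by blast+

lemma anchoredD:
  assumes "anchored \<psi> c d q E" "r \<sqsubseteq> q" "over (X \<inter> {len q..}) E E'" "good e c r E'"
  shows "often X E' (prints_from \<psi> n)"
    and "len q \<le> w \<Longrightarrow> w < len r \<Longrightarrow> computes \<psi> (2 * len r) E' w \<Longrightarrow> lm r w = d"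
    and "len q \<le> v \<Longrightarrow> v < w \<Longrightarrow> w < len r \<Longrightarrow> computes \<psi> (2 * len r) E' v
      \<Longrightarrow> computes \<psi> (2 * len r) E' w \<Longrightarrow> pt r v w = d"
  using assms unfolding anchored_def by blast+

lemma anchored_mono:
  assumes "anchored \<psi> c d q E" "r \<sqsubseteq> q" "over (X \<inter> {len q..}) E E'" "good e c r E'"
  shows "anchored \<psi> c d r E'"
proof -
  have *: "s \<sqsubseteq> q" "over (X \<inter> {len q..}) E F" if "s \<sqsubseteq> r" "over (X \<inter> {len r..}) E' F" for s F
    using below_trans[OF that(1) assms(2)] over_step[OF assms(3) that(2) subset_refl below_len[OF assms(2)]]
    by auto
  show ?thesis
    unfolding anchored_def
  proof (intro conjI allI impI; (elim conjE)?)
    show "r \<sqsubseteq> P" using assms(2) anchored_P[OF assms(1)] by (rule below_trans)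
    show "good e c r E'" by fact
    fix s F assume s: "s \<sqsubseteq> r" "over (X \<inter> {len r..}) E' F" "good e c s F"
    note D = anchoredD[OF assms(1) * s(3), OF s(1,2) s(1,2)]
    show "often X F (prints_from \<psi> n)" for n by (rule D(1))
    show "lm s w = d" if "len r \<le> w" "w < len s" "computes \<psi> (2 * len s) F w" for w
      using that below_len[OF assms(2)] by (intro D(2)) auto
    show "pt s v w = d" if "len r \<le> v" "v < w" "w < len s" "computes \<psi> (2 * len s) F v"
      "computes \<psi> (2 * len s) F w" for v w
      using that below_len[OF assms(2)] by (intro D(3)) auto
  qed
qed

lemma anchored_below:
  assumes "anchored \<psi> c d q E" "r \<sqsubseteq> q"
  shows "anchored \<psi> c d r E"
proof -
  note g = anchored_good[OF assms(1)]
  show ?thesis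
    using assms over_refl[OF good_finite[OF g] good_inj[OF g]] good_mono[OF g assms(2)]
    by (rule anchored_mono)
qed

lemma realize_computes:
  assumes "q \<sqsubseteq> P" "good e c q E" "rich c q Y" "often Y E (prints \<psi> w)"
  obtains r E' where "r \<sqsubseteq> q" "good e c r E'" "over (Y \<inter> {len q..}) E E'" "N \<le> len r"
    "computes \<psi> (2 * len r) E' w"
proof -
  obtain r E' where r: "r \<sqsubseteq> q" "good e c r E'" "over (Y \<inter> {len q..}) E E'" "prints \<psi> w E'"
    using realize[OF assms] by blast
  obtain m where m: "\<And>n. m \<le> n \<Longrightarrow> computes \<psi> n E' w" using prints_computes[OF r(4)] by blast
  obtain s where s: "s \<sqsubseteq> r" "max m N \<le> len s" using lengthen[of r "max m N"] by blast
  show thesis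
    using below_trans[OF s(1) r(1)] good_mono[OF r(2) s(1)] r(3)
    by (rule that) (use s(2) m in auto)
qed

text \<open>The first printed number \<open>w0\<close> fixes the color \<open>d\<close>: a later output with another limit, together
  with \<open>w0\<close> and a still later output, would be inhomogeneous.\<close>

lemma stuck:
  assumes "q \<sqsubseteq> P" "\<not> dens e X c q"
  obtains r N where "r \<sqsubseteq> q" "\<And>r' x. r' \<sqsubseteq> r \<Longrightarrow> x \<in> X \<Longrightarrow> N \<le> x \<Longrightarrow> \<not> lims e r' x c"
  | r \<psi> d E where "r \<sqsubseteq> q" "anchored \<psi> c d r E"
proof -
  obtain t r E where r: "r \<sqsubseteq> q" "good e c r E" and no: "\<And>r' E'. r' \<sqsubseteq> r \<Longrightarrow>
      over (X \<inter> {len r..}) E E' \<Longrightarrow> good e c r' E' \<Longrightarrow> \<not> meets X t r' E'"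
    using assms(2) unfolding dens_def by blast
  have rP: "r \<sqsubseteq> P" using r(1) assms(1) by (rule below_trans)
  show thesis
  proof (cases "rich c r X")
    case False
    then obtain r' N where r': "r' \<sqsubseteq> r" "\<And>s x. s \<sqsubseteq> r' \<Longrightarrow> x \<in> X \<Longrightarrow> N \<le> x \<Longrightarrow> \<not> lims e s x c"
      unfolding rich_def by blast
    show thesis using below_trans[OF r'(1) r(1)] r'(2) by (rule that(1))
  next
    case rich: True
    show thesis
    proof (cases t)
      \<comment> \<open>While \<open>X\<close> is rich, a large element can always be added to side
        \<open>s\<close>, so the unmet requirement must concern a functional.\<close>
      case (Inr Ns)
      obtain N s where Ns: "Ns = (N, s)" by (cases Ns)
      obtain r' x where x: "r' \<sqsubseteq> r" "x \<in> X" "max N (len r) \<le> x" "lims e r' x c"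
        using rich[unfolded rich_def, rule_format, OF below_refl, of "max N (len r)"] by blast
      then obtain r'' where r'': "r'' \<sqsubseteq> r'" "good e c r'' (insert (tag s x) E)"
        using good_insert[OF rP r(2), of r' x s] by auto
      have "over (X \<inter> {len r..}) E (insert (tag s x) E)"
        using good_inj[OF r''(2)] good_finite[OF r(2)] x(2,3) by (intro over_insert) auto
      moreover have "meets X t r'' (insert (tag s x) E)"
        using x(3) tag_ge(1)[of x s] by (simp add: meets_def Inr Ns)
      ultimately show thesis using no[OF below_trans[OF r''(1) x(1)] _ r''(2)] by blast
    next
      case (Inl \<psi>)
      have nowin: "\<not> win X \<psi> s F" if "s \<sqsubseteq> r" "over (X \<inter> {len r..}) E F" "good e c s F" for s F
        using no[OF that] by (simp add: meets_def Inl)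
      \<comment> \<open>Otherwise the reservoir would forbid printing on a tail, and lengthening the
        condition past its start would defeat \<open>\<psi>\<close>.\<close>
      have alive: "often X F (prints_from \<psi> n)"
        if s: "s \<sqsubseteq> r" "over (X \<inter> {len r..}) E F" "good e c s F" for s F n
      proof (rule ccontr)
        assume "\<not> often X F (prints_from \<psi> n)"
        then obtain m where m: "\<And>F'. over (X \<inter> {m..}) F F' \<Longrightarrow> \<not> prints_from \<psi> n F'"
          using reservoir_refuses[OF res good_finite[OF s(3)], of "prints_from \<psi> n"] by blast
        obtain s' where s': "s' \<sqsubseteq> s" "m \<le> len s'" using lengthen[of s m] by blast
        have "\<not> prints_from \<psi> n F'" if "over (X \<inter> {len s'..}) F F'" for F'
          using m over_mono[OF that, of "X \<inter> {m..}"] s'(2) by fastforce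
        then have "win X \<psi> s' F" unfolding win_def by blast
        then show False using nowin[OF below_trans[OF s'(1) s(1)] s(2) good_mono[OF s(3) s'(1)]] by blast
      qed
      have extend: "\<exists>s' F' w. s' \<sqsubseteq> s \<and> over (X \<inter> {len s..}) F F' \<and> good e c s' F' \<and> n \<le> w
          \<and> w < len s' \<and> computes \<psi> (2 * len s') F' w"
        if s: "s \<sqsubseteq> r" "over (X \<inter> {len r..}) E F" "good e c s F" for s F n
      proof -
        obtain s' F' where s': "s' \<sqsubseteq> s" "good e c s' F'" "over (X \<inter> {len s..}) F F'"
          "prints_from \<psi> n F'"
          using realize[OF below_trans[OF s(1) rP] s(3) rich_mono[OF rich s(1)] alive[OF s]] by blast
        then obtain w where w: "n \<le> w" "prints \<psi> w F'" unfolding prints_from_def by blast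
        obtain m where m: "\<And>i. m \<le> i \<Longrightarrow> computes \<psi> i F' w" using prints_computes[OF w(2)] by blast
        obtain s'' where s'': "s'' \<sqsubseteq> s'" "max m (Suc w) \<le> len s''"
          using lengthen[of s' "max m (Suc w)"] by blast
        have "w < len s''" "computes \<psi> (2 * len s'') F' w" using s''(2) m by auto
        then show ?thesis
          using below_trans[OF s''(1) s'(1)] s'(3) good_mono[OF s'(2) s''(1)] w(1) by blast
      qed
      have "over (X \<inter> {len r..}) E E" using good_finite[OF r(2)] good_inj[OF r(2)] by (rule over_refl)
      then obtain r1 E1 w0 where r1: "r1 \<sqsubseteq> r" "over (X \<inter> {len r..}) E E1" "good e c r1 E1"
        and w0: "w0 < len r1" "computes \<psi> (2 * len r1) E1 w0"
        using extend[OF below_refl _ r(2), of 0] by blast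
      have "anchored \<psi> c (lm r1 w0) r1 E1"
        unfolding anchored_def
      proof (intro conjI allI impI; (elim conjE)?)
        show "r1 \<sqsubseteq> P" using r1(1) rP by (rule below_trans)
        show "good e c r1 E1" by fact
        fix r2 E2 assume r2: "r2 \<sqsubseteq> r1" "over (X \<inter> {len r1..}) E1 E2" "good e c r2 E2"
        have r2r: "r2 \<sqsubseteq> r" using r2(1) r1(1) by (rule below_trans)
        have E2: "over (X \<inter> {len r..}) E E2"
          using over_step[OF r1(2) r2(2) subset_refl below_len[OF r1(1)]] .
        show "often X E2 (prints_from \<psi> n)" for n using alive[OF r2r E2 r2(3)] .
        have c0: "computes \<psi> (2 * len r2) E2 w0"
          using computes_over[OF w0(2) r2(2) below_len[OF r2(1)]] .
        have pt0: "pt r2 w0 w = lm r1 w0" if "len r1 \<le> w" "w < len r2" for w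
          using below_pt_lm[OF r2(1) w0(1) that] .
        show "pt r2 v w = lm r1 w0" if vw: "len r1 \<le> v" "v < w" "w < len r2"
          "computes \<psi> (2 * len r2) E2 v" "computes \<psi> (2 * len r2) E2 w" for v w
        proof (rule ccontr)
          assume "pt r2 v w \<noteq> lm r1 w0"
          then have "win X \<psi> r2 E2"
            using vw c0 pt0[of w] w0(1) by (intro winI[of v w r2 w0 w]) auto
          then show False using nowin[OF r2r E2 r2(3)] by blast
        qed
        show "lm r2 w = lm r1 w0"
          if w: "len r1 \<le> w" "w < len r2" "computes \<psi> (2 * len r2) E2 w" for w
        proof (rule ccontr)
          assume neq: "lm r2 w \<noteq> lm r1 w0"
          obtain r3 E3 w' where r3: "r3 \<sqsubseteq> r2" "over (X \<inter> {len r2..}) E2 E3" "good e c r3 E3"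
            and w': "len r2 \<le> w'" "w' < len r3" "computes \<psi> (2 * len r3) E3 w'"
            using extend[OF r2r E2 r2(3), of "len r2"] by blast
          have comp: "computes \<psi> (2 * len r3) E3 w0" "computes \<psi> (2 * len r3) E3 w"
            using computes_over[OF _ r3(2) below_len[OF r3(1)]] c0 w(3) by blast+
          have "pt r3 w0 w = lm r1 w0"
            using below_pt[OF r3(1), of w0 w] pt0[OF w(1,2)] w0(1) w(1,2) by auto
          moreover have "pt r3 w w' = lm r2 w" using below_pt_lm[OF r3(1) w(2) w'(1,2)] .
          ultimately have "win X \<psi> r3 E3"
            using neq comp w' w0(1) w(1,2) by (intro winI[of w0 w r3 w w']) auto
          then show False
            using nowin[OF below_trans[OF r3(1) r2r] _ r3(3)]
              over_step[OF E2 r3(2) subset_refl below_len[OF r2r]] by blast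
        qed
      qed
      then show thesis using that(2) below_trans[OF r1(1) r(1)] by blast
    qed
  qed
qed

text \<open>The printing of \<open>w\<close> can be realized below \<open>r\<close> inside
  \<open>Y\<close>. This leaves the promise at \<open>w\<close> untouched, as
  \<open>w < len r\<close>, and being anchored determines its value.\<close>

lemma promise_lm:
  assumes anch: "anchored \<psi> c d q E" and r: "r \<sqsubseteq> q" "over (X \<inter> {len q..}) E E'" "good e c r E'"
    and Y: "rich c r Y" "Y \<subseteq> X" and w: "often X E' (prints \<psi> w)" "len q \<le> w" "w < len r"
  shows "lm r w = d"
proof -
  have "r \<sqsubseteq> P" using r(1) anchored_P[OF anch] by (rule below_trans)
  then obtain s F where s: "s \<sqsubseteq> r" "good e c s F" "over (Y \<inter> {len r..}) E' F"
    "computes \<psi> (2 * len s) F w"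
    using realize_computes[OF _ r(3) Y(1) often_mono[OF w(1) Y(2)]] by blast
  have "lm s w = d"
    using anchoredD(2)[OF anch below_trans[OF s(1) r(1)]
        over_step[OF r(2) s(3) Y(2) below_len[OF r(1)]] s(2) w(2) _ s(4)]
      below_len[OF s(1)] w(3) by simp
  then show ?thesis using below_lm[OF s(1) w(3)] by simp
qed

text \<open>Otherwise the limit of \<open>w\<close> would still be free and could be promised as
  \<open>\<not> d\<close>, against \<open>promise_lm\<close>.\<close>

lemma promise_less:
  assumes anch: "anchored \<psi> c d q E" and "rich c q Y" "Y \<subseteq> X" "often X E (prints \<psi> w)"
  shows "w < len q"
proof (rule ccontr)
  assume "\<not> w < len q"
  then have w: "len q \<le> w" by simp
  obtain r where r: "r \<sqsubseteq> q" "Suc w \<le> len r" "\<And>v. len q \<le> v \<Longrightarrow> lm r v = (\<not> d)"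
    using lengthen[of q "Suc w" "\<lambda>_. \<not> d"] by blast
  note g = anchored_good[OF anch]
  have "lm r w = d"
    using promise_lm[OF anch r(1) over_refl[OF good_finite[OF g] good_inj[OF g]] good_mono[OF g r(1)]
        rich_mono[OF assms(2) r(1)] assms(3,4) w] r(2) by simp
  then show False using r(3)[OF w] by simp
qed

text \<open>Once \<open>x\<close> with limit \<open>c\<close> has joined the stem, \<open>w\<close>
  falls under \<open>promise_lm\<close>. This ties the limit of the computed coloring at
  \<open>x\<close> to that of the generic coloring at \<open>w\<close>.\<close>

lemma promise_link:
  assumes anch: "anchored \<psi> c d q E" and Y: "rich c q Y" "Y \<subseteq> X"
    and x: "x \<in> X" "len q \<le> x" "often X (insert (tag s x) E) (prints \<psi> w)" "len q \<le> w"
    and r: "r \<sqsubseteq> q" "lims e r x c" "w < len r"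
  shows "lm r w = d"
proof -
  obtain r' where r': "r' \<sqsubseteq> r" "good e c r' (insert (tag s x) E)"
    using good_insert[OF anchored_P[OF anch] anchored_good[OF anch] r(1) x(2) r(2)] by blast
  have "over (X \<inter> {len q..}) E (insert (tag s x) E)"
    using good_inj[OF r'(2)] good_finite[OF anchored_good[OF anch]] x(1,2) by (intro over_insert) auto
  moreover have r'q: "r' \<sqsubseteq> q" using r'(1) r(1) by (rule below_trans)
  ultimately have "lm r' w = d"
    using promise_lm[OF anch r'q _ r'(2) rich_mono[OF Y(1) r'q] Y(2) x(3,4)] below_len[OF r'(1)] r(3)
    by simp
  then show ?thesis using below_lm[OF r'(1) r(3)] by simp
qed

text \<open>Each \<open>x\<close> in \<open>Y'\<close>, once added on side \<open>s\<close>, makes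
  \<open>\<zeta> x\<close> printable inside every infinite part of the reservoir; injectivity makes
  these numbers arbitrarily large.\<close>

definition ready :: "recf \<Rightarrow> nat set \<Rightarrow> nat set \<Rightarrow> bool \<Rightarrow> nat set \<Rightarrow> (nat \<Rightarrow> nat) \<Rightarrow> bool" where
  "ready \<psi> Y E s Y' \<zeta> \<longleftrightarrow> Y' \<subseteq> Y \<and> infinite Y' \<and> inj_on \<zeta> Y'
     \<and> (\<forall>x\<in>Y'. often X (insert (tag s x) E) (prints \<psi> (\<zeta> x)))"

text \<open>Otherwise infinitely many \<open>x\<close> would each promise some number from
  \<open>b\<close> on. A number promised by infinitely many \<open>x\<close> would be printable from
  \<open>E\<close> on every tail, contrary to the dichotomy of the reservoir; so fibers are finite,
  and an injective choice makes \<open>E\<close> ready.\<close>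

lemma quiet_step:
  assumes "finite E" "Y \<subseteq> X" and quiet: "\<And>v. b \<le> v \<Longrightarrow> \<not> often X E (prints \<psi> v)"
    and not_ready: "\<And>Y' \<zeta>. \<not> ready \<psi> Y E s Y' \<zeta>"
  shows "\<exists>K. \<forall>x\<in>Y. K \<le> x \<longrightarrow> (\<forall>v\<ge>b. \<not> often X (insert (tag s x) E) (prints \<psi> v))"
proof (rule ccontr)
  assume contra: "\<nexists>K. \<forall>x\<in>Y. K \<le> x \<longrightarrow> (\<forall>v\<ge>b. \<not> often X (insert (tag s x) E) (prints \<psi> v))"
  define B where "B = {x \<in> Y. \<exists>v\<ge>b. often X (insert (tag s x) E) (prints \<psi> v)}"
  have "\<exists>x\<ge>K. x \<in> B" for K using contra unfolding B_def by blast
  then have "infinite B" by (simp add: infinite_nat_iff_unbounded_le)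
  define \<zeta> where "\<zeta> x = (SOME v. b \<le> v \<and> often X (insert (tag s x) E) (prints \<psi> v))" for x
  have \<zeta>: "b \<le> \<zeta> x \<and> often X (insert (tag s x) E) (prints \<psi> (\<zeta> x))" if "x \<in> B" for x
    unfolding \<zeta>_def by (rule someI_ex) (use that in \<open>auto simp: B_def\<close>)
  have "finite {x \<in> B. \<zeta> x = v}" for v
  proof (rule ccontr)
    assume inf: "infinite {x \<in> B. \<zeta> x = v}"
    then obtain x0 where "x0 \<in> B" "\<zeta> x0 = v" using infinite_natD by blast
    then have "b \<le> v" using \<zeta> by blast
    then obtain m where m: "\<And>E'. over (X \<inter> {m..}) E E' \<Longrightarrow> \<not> prints \<psi> v E'"
      using reservoir_refuses[OF res assms(1), of "prints \<psi> v"] quiet by blast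
    obtain x where x: "x \<in> B" "\<zeta> x = v" "m \<le> x" using infinite_natD[OF inf, of m] by blast
    then have xX: "x \<in> X \<inter> {m..}" using assms(2) by (auto simp: B_def)
    have "infinite (X \<inter> {m..})" using res infinite_tail by (auto simp: reservoir_def)
    moreover have "often X (insert (tag s x) E) (prints \<psi> v)" using \<zeta> x by blast
    ultimately obtain E' where "over (X \<inter> {m..}) (insert (tag s x) E) E'" "prints \<psi> v E'"
      using oftenD[OF _ Int_lower1] by blast
    then show False using m over_insertD xX by blast
  qed
  then obtain B' where "B' \<subseteq> B" "infinite B'" "inj_on \<zeta> B'"
    using infinite_inj_subset[OF \<open>infinite B\<close>] by blast
  then have "ready \<psi> Y E s B' \<zeta>" using \<zeta> unfolding ready_def B_def by blast
  then show False using not_ready by blast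
qed

text \<open>If no finite extension were ready, thinning would give a reservoir on which nothing new is
  ever promised, hence nothing new is printed.\<close>

lemma ready_exists:
  assumes anch: "anchored \<psi> c d q E" and Y: "Y \<subseteq> X" "rich c q Y"
  obtains r E' s Y' \<zeta> where "r \<sqsubseteq> q" "over (Y \<inter> {len q..}) E E'" "good e c r E'" "ready \<psi> Y E' s Y' \<zeta>"
proof (rule ccontr)
  assume "\<not> thesis"
  then have not_ready: "\<And>r E' s Y' \<zeta>. r \<sqsubseteq> q \<Longrightarrow> over (Y \<inter> {len q..}) E E' \<Longrightarrow> good e c r E'
      \<Longrightarrow> \<not> ready \<psi> Y E' s Y' \<zeta>" using that by blast
  note qP = anchored_P[OF anch] and g = anchored_good[OF anch]
  define quiet where "quiet E' \<longleftrightarrow> (\<forall>v\<ge>len q. \<not> often X E' (prints \<psi> v))" for E'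
  obtain Z where Z: "Z \<subseteq> Y \<inter> {len q..}" "infinite Z"
    "\<And>E'. over Z E E' \<Longrightarrow> \<exists>r. r \<sqsubseteq> q \<and> good e c r E'"
    using homogeneous_reservoir[OF qP g Y(2)] by blast
  have step: "\<exists>K. \<forall>s. \<forall>x\<in>Y. K \<le> x \<longrightarrow> quiet (insert (tag s x) E')"
    if E': "over Z E E'" "quiet E'" for E'
  proof -
    obtain r where r: "r \<sqsubseteq> q" "good e c r E'" using Z(3)[OF E'(1)] by blast
    have "\<exists>K. \<forall>x\<in>Y. K \<le> x \<longrightarrow> quiet (insert (tag s x) E')" for s
      using quiet_step[OF over_finite[OF E'(1)] Y(1), of "len q" \<psi> s] E'(2)
        not_ready[OF r(1) over_mono[OF E'(1) Z(1)] r(2)]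
      unfolding quiet_def by blast
    then obtain K where K: "\<And>s x. x \<in> Y \<Longrightarrow> K s \<le> x \<Longrightarrow> quiet (insert (tag s x) E')" by metis
    have "quiet (insert (tag s x) E')" if "x \<in> Y" "max (K True) (K False) \<le> x" for s x
      using that K[of x s] by (cases s) auto
    then show ?thesis by blast
  qed
  \<comment> \<open>For quiet \<open>E'\<close>, every number of \<open>Y\<close> from
    \<open>T E'\<close> on can be added without losing quietness; \<open>infinite_thin\<close> then
    spaces out \<open>Z'\<close> accordingly.\<close>
  define T where "T E' = (SOME K. \<forall>s. \<forall>x\<in>Y. K \<le> x \<longrightarrow> quiet (insert (tag s x) E'))" for E'
  have T: "quiet (insert (tag s x) E')" if "over Z E E'" "quiet E'" "x \<in> Y" "T E' \<le> x" for E' s x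
    using someI_ex[OF step[OF that(1,2)]] that(3,4) unfolding T_def by blast
  obtain Z' where Z': "Z' \<subseteq> Z" "infinite Z'"
    "\<And>F x. x \<in> Z' \<Longrightarrow> F \<subseteq> {..<2 * len q} \<union> {k. k div 2 \<in> Z' \<and> k div 2 < x} \<Longrightarrow> T F \<le> x"
    using infinite_thin[OF Z(2), where T = T and m = "len q"] by blast
  have quiet: "quiet E'" if "over Z' E E'" for E'
    using that
  proof (induction "card E'" arbitrary: E' rule: less_induct)
    case less
    note E' = less.prems
    have fin: "finite (E' - E)" using over_finite[OF E'] by simp
    show ?case
    proof (cases "E' - E = {}")
      case True
      then have "E' = E" using over_subset[OF E'] by blast
      then show ?thesis
        using promise_less[OF anch Y(2,1)] unfolding quiet_def by (meson not_le)
    next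
      case False
      \<comment> \<open>Removing the largest new code leaves a set whose new numbers are below
        \<open>k div 2\<close>, as the bound on \<open>T\<close> requires.\<close>
      define k where "k = Max (E' - E)"
      have k: "k \<in> E'" "k \<notin> E" using Max_in[OF fin False] unfolding k_def by auto
      have kZ: "k div 2 \<in> Z'" using over_new[OF E' k] .
      let ?F = "E' - {k}"
      have F: "over Z' E ?F" using E' k(2) unfolding over_def by (auto simp: inj_on_diff)
      have "card ?F < card E'" using over_finite[OF E'] k(1) by (rule card_Diff1_less)
      then have "quiet ?F" using less.hyps F by blast
      moreover have "T ?F \<le> k div 2"
      proof (rule Z'(3)[OF kZ], rule subsetI)
        fix j assume j: "j \<in> ?F"
        show "j \<in> {..<2 * len q} \<union> {i. i div 2 \<in> Z' \<and> i div 2 < k div 2}"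
        proof (cases "j \<in> E")
          case True
          then show ?thesis using good_less[OF g] by blast
        next
          case False
          then have "j \<le> k" using j fin unfolding k_def by (intro Max_ge) auto
          then have "j < k" using j by (simp add: order_less_le)
          then have "j div 2 < k div 2" using inj_div2_less[OF over_inj[OF E']] j k(1) by blast
          then show ?thesis using over_new[OF E' _ False] j by blast
        qed
      qed
      moreover have "k div 2 \<in> Y" using kZ Z'(1) Z(1) by blast
      ultimately have "quiet (insert (tag (odd k) (k div 2)) ?F)"
        using T over_mono[OF F Z'(1)] by blast
      then show ?thesis using k(1) by (simp add: insert_absorb)
    qed
  qed
  have "often X E (prints_from \<psi> (len q))"
    using anchoredD(1)[OF anch below_refl over_refl[OF good_finite[OF g] good_inj[OF g]] g] .
  moreover have "Z' \<subseteq> X" using Z'(1) Z(1) Y(1) by blast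
  ultimately obtain E' where E': "over Z' E E'" "prints_from \<psi> (len q) E'"
    using oftenD Z'(2) by blast
  then obtain w where w: "len q \<le> w" "prints \<psi> w E'" unfolding prints_from_def by blast
  \<comment> \<open>A stem that already prints \<open>w\<close> is its own extension inside every
    subset.\<close>
  have "often X E' (prints \<psi> w)"
    unfolding often_def using over_refl[OF over_finite[OF E'(1)] over_inj[OF E'(1)]] w(2) by blast
  then show False using quiet[OF E'(1)] w(1) unfolding quiet_def by blast
qed

text \<open>One half of the mirror, for a single color \<open>c\<close>; links for the two opposite
  colors will combine into an equivalence.\<close>

definition linked :: "bool \<Rightarrow> bool \<Rightarrow> cond \<Rightarrow> nat set \<Rightarrow> (nat \<Rightarrow> nat) \<Rightarrow> bool" where
  "linked c d q Y z \<longleftrightarrow> infinite Y \<and> inj_on z Y \<and> (\<forall>x\<in>Y. len q \<le> x \<and> len q \<le> z x)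
     \<and> (\<forall>r x. r \<sqsubseteq> q \<and> x \<in> Y \<and> lims e r x c \<and> z x < len r \<longrightarrow> lm r (z x) = d)"

lemma linkedD:
  assumes "linked c d q Y z"
  shows "infinite Y" "inj_on z Y" "x \<in> Y \<Longrightarrow> len q \<le> x" "x \<in> Y \<Longrightarrow> len q \<le> z x"
    "r \<sqsubseteq> q \<Longrightarrow> x \<in> Y \<Longrightarrow> lims e r x c \<Longrightarrow> z x < len r \<Longrightarrow> lm r (z x) = d"
  using assms unfolding linked_def by blast+

lemma linked_trim:
  assumes "linked c d q Y z" "r \<sqsubseteq> q" "Y' \<subseteq> Y" "infinite Y'"
  shows "linked c d r {x \<in> Y'. len r \<le> x \<and> len r \<le> z x} z"
  unfolding linked_def
proof (intro conjI)
  have inj: "inj_on z Y'" using linkedD(2)[OF assms(1)] assms(3) by (rule inj_on_subset)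
  show "infinite {x \<in> Y'. len r \<le> x \<and> len r \<le> z x}" using assms(4) inj by (rule infinite_trim)
  show "inj_on z {x \<in> Y'. len r \<le> x \<and> len r \<le> z x}" by (rule inj_on_subset[OF inj]) blast
  show "\<forall>s x. s \<sqsubseteq> r \<and> x \<in> {x \<in> Y'. len r \<le> x \<and> len r \<le> z x} \<and> lims e s x c \<and> z x < len s
      \<longrightarrow> lm s (z x) = d"
    using linkedD(5)[OF assms(1)] below_trans[OF _ assms(2)] assms(3) by blast
qed blast

text \<open>Either outcome of \<open>stuck\<close> yields a link: if the limit \<open>c\<close> is
  impossible on a tail, the implication is vacuous; otherwise, unless \<open>Y\<close> fails to be
  rich, a ready stem supplies the numbers \<open>z x\<close> and \<open>promise_link\<close> their
  limits.\<close>

lemma linked_exists: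
  assumes q: "q \<sqsubseteq> P" "\<not> dens e X c q" and Y: "Y \<subseteq> X" "infinite Y"
  obtains r Y' z d where "r \<sqsubseteq> q" "Y' \<subseteq> Y" "linked c d r Y' z"
    "(\<forall>r' x. r' \<sqsubseteq> r \<and> x \<in> Y' \<longrightarrow> \<not> lims e r' x c) \<or> (\<exists>\<psi> E. anchored \<psi> c d r E)"
proof -
  note result = that
  have vacuous: thesis
    if r: "r \<sqsubseteq> q" "\<And>r' x. r' \<sqsubseteq> r \<Longrightarrow> x \<in> Y \<Longrightarrow> N \<le> x \<Longrightarrow> \<not> lims e r' x c" for r N
  proof (rule result[OF r(1)])
    \<comment> \<open>With the implication vacuous, \<open>True\<close> and the identity serve as
      default values of \<open>d\<close> and \<open>z\<close>.\<close>
    let ?Y' = "Y \<inter> {max N (len r)..}"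
    have vac: "\<forall>r' x. r' \<sqsubseteq> r \<and> x \<in> ?Y' \<longrightarrow> \<not> lims e r' x c" using r(2) by auto
    then show "(\<forall>r' x. r' \<sqsubseteq> r \<and> x \<in> ?Y' \<longrightarrow> \<not> lims e r' x c) \<or> (\<exists>\<psi> E. anchored \<psi> c True r E)"
      by blast
    have "infinite ?Y'" using Y(2) by (rule infinite_tail)
    then show "linked c True r ?Y' (\<lambda>x. x)"
      using vac unfolding linked_def by auto
  qed blast
  from q show thesis
  proof (cases rule: stuck)
    case (1 r N)
    then show thesis using vacuous Y(1) by blast
  next
    case (2 r \<psi> d E)
    show thesis
    proof (cases "rich c r Y")
      case False
      then obtain r' N where r': "r' \<sqsubseteq> r" "\<And>s x. s \<sqsubseteq> r' \<Longrightarrow> x \<in> Y \<Longrightarrow> N \<le> x \<Longrightarrow> \<not> lims e s x c"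
        unfolding rich_def by blast
      show thesis using below_trans[OF r'(1) 2(1)] r'(2) by (rule vacuous)
    next
      case True
      obtain r1 E1 s Y1 \<zeta> where r1: "r1 \<sqsubseteq> r" "over (Y \<inter> {len r..}) E E1" "good e c r1 E1"
        and rd: "ready \<psi> Y E1 s Y1 \<zeta>"
        using ready_exists[OF 2(2) Y(1) True] by blast
      have anch: "anchored \<psi> c d r1 E1"
        by (rule anchored_mono[OF 2(2) r1(1) over_mono[OF r1(2)] r1(3)]) (use Y(1) in blast)
      have Y1: "Y1 \<subseteq> Y" "infinite Y1" "inj_on \<zeta> Y1"
        "\<And>x. x \<in> Y1 \<Longrightarrow> often X (insert (tag s x) E1) (prints \<psi> (\<zeta> x))"
        using rd unfolding ready_def by blast+
      let ?Y' = "{x \<in> Y1. len r1 \<le> x \<and> len r1 \<le> \<zeta> x}"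
      have "linked c d r1 ?Y' \<zeta>"
        unfolding linked_def
      proof (intro conjI allI impI; (elim conjE)?)
        show "infinite ?Y'" using Y1(2,3) by (rule infinite_trim)
        show "inj_on \<zeta> ?Y'" by (rule inj_on_subset[OF Y1(3)]) blast
        show "\<forall>x\<in>?Y'. len r1 \<le> x \<and> len r1 \<le> \<zeta> x" by blast
        fix r2 x assume r2: "r2 \<sqsubseteq> r1" "x \<in> ?Y'" "lims e r2 x c" "\<zeta> x < len r2"
        then have x: "x \<in> X" "len r1 \<le> x" "len r1 \<le> \<zeta> x"
          "often X (insert (tag s x) E1) (prints \<psi> (\<zeta> x))"
          using Y1(1,4) Y(1) by blast+
        show "lm r2 (\<zeta> x) = d"
          using promise_link[OF anch rich_mono[OF True r1(1)] Y(1) x(1,2,4,3) r2(1,3,4)] .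
      qed
      moreover have "?Y' \<subseteq> Y" using Y1(1) by blast
      ultimately show thesis using result below_trans[OF r1(1) 2(1)] anch by blast
    qed
  qed
qed

end

subsection \<open>Colorings whose limits mirror those of the given coloring\<close>

locale mirror = forcing +
  fixes c d :: bool and q :: cond and Y :: "nat set" and z :: "nat \<Rightarrow> nat"
  assumes qP: "q \<sqsubseteq> P" and infY: "infinite Y" and YX: "Y \<subseteq> X" and inj: "inj_on z Y"
    and far: "x \<in> Y \<Longrightarrow> len q \<le> x" "x \<in> Y \<Longrightarrow> len q \<le> z x"
    and reflect: "r \<sqsubseteq> q \<Longrightarrow> x \<in> Y \<Longrightarrow> lims e r x c' \<Longrightarrow> z x < len r \<Longrightarrow> lm r (z x) = d \<longleftrightarrow> c' = c"
begin

text \<open>Some limit at \<open>x\<close> can be forced, and the promise \<open>d\<close> at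
  \<open>z x\<close> leaves only \<open>c\<close>.\<close>

lemma settle_mirrored:
  assumes "finite S" "r \<sqsubseteq> q" "\<And>x. x \<in> S \<Longrightarrow> x \<in> Y \<and> z x < len r \<and> lm r (z x) = d"
  shows "\<exists>r'. r' \<sqsubseteq> r \<and> (\<forall>x\<in>S. lims e r' x c)"
  using assms(1,3)
proof (induction S rule: finite_induct)
  case empty
  then show ?case using below_refl by blast
next
  case (insert x S)
  then obtain r1 where r1: "r1 \<sqsubseteq> r" "\<forall>x\<in>S. lims e r1 x c" by blast
  have r1q: "r1 \<sqsubseteq> q" using r1(1) assms(2) by (rule below_trans)
  obtain r2 c' where r2: "r2 \<sqsubseteq> r1" "lims e r2 x c'" using settle below_trans[OF r1q qP] by blast
  have x: "x \<in> Y" "z x < len r" "lm r (z x) = d" using insert.prems by auto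
  have r2r: "r2 \<sqsubseteq> r" using r2(1) r1(1) by (rule below_trans)
  have "lm r2 (z x) = d" using below_lm[OF r2r x(2)] x(3) by simp
  moreover have "z x < len r2" using x(2) below_len[OF r2r] by simp
  ultimately have "c' = c" using reflect[OF below_trans[OF r2(1) r1q] x(1) r2(2)] by simp
  then show ?case using r2r r2(2) r1(2) lims_mono[OF _ r2(1)] by blast
qed

text \<open>For late \<open>x\<close> the number \<open>z x\<close> is not yet promised, so it can
  be given limit \<open>d\<close> before \<open>x\<close> is settled.\<close>

lemma rich_mirrored:
  assumes "Y' \<subseteq> Y" "infinite Y'"
  shows "rich c q Y'"
  unfolding rich_def
proof (intro allI impI)
  fix r N assume r: "r \<sqsubseteq> q"
  have "infinite {x \<in> Y'. max N (len r) \<le> x \<and> max N (len r) \<le> z x}"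
    using assms(2) inj_on_subset[OF inj assms(1)] by (rule infinite_trim)
  then obtain x where "x \<in> {x \<in> Y'. max N (len r) \<le> x \<and> max N (len r) \<le> z x}"
    using infinite_natD by blast
  then have x: "x \<in> Y'" "N \<le> x" "len r \<le> z x" by auto
  obtain s where s: "s \<sqsubseteq> r" "Suc (z x) \<le> len s" "\<And>v. len r \<le> v \<Longrightarrow> lm s v = d"
    using lengthen[of r "Suc (z x)" "\<lambda>_. d"] by blast
  have "\<exists>s'. s' \<sqsubseteq> s \<and> (\<forall>y\<in>{x}. lims e s' y c)"
    by (rule settle_mirrored[OF _ below_trans[OF s(1) r]]) (use x s(2,3) assms(1) in auto)
  then obtain s' where "s' \<sqsubseteq> s" "lims e s' x c" by blast
  then show "\<exists>r' x. r' \<sqsubseteq> r \<and> x \<in> Y' \<and> N \<le> x \<and> lims e r' x c"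
    using below_trans[OF _ s(1)] x(1,2) by blast
qed

end

section \<open>An anchored color inside a mirror is impossible\<close>

locale anchored_mirror = mirror +
  fixes \<psi> :: recf and E :: "nat set"
  assumes anch: "anchored \<psi> c d q E"
begin

definition reaches :: "cond \<Rightarrow> nat set \<Rightarrow> bool" where
  "reaches r F \<longleftrightarrow> r \<sqsubseteq> q \<and> over Y E F \<and> good e c r F"

text \<open>The measure of progress for \<open>contradiction\<close>: side \<open>s\<close> holds a
  new element whose own mirror is already an output.\<close>

definition printed :: "bool \<Rightarrow> cond \<Rightarrow> nat set \<Rightarrow> bool" where
  "printed s r F \<longleftrightarrow> (\<exists>k\<in>F - E. odd k = s \<and> z (k div 2) < len r
     \<and> computes \<psi> (2 * len r) F (z (k div 2)))"

lemma reachesD: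
  assumes "reaches r F"
  shows "r \<sqsubseteq> q" "over Y E F" "over (X \<inter> {len q..}) E F" "good e c r F" "r \<sqsubseteq> P" "anchored \<psi> c d r F"
    "rich c r Y"
proof -
  show r: "r \<sqsubseteq> q" "over Y E F" "good e c r F" using assms by (auto simp: reaches_def)
  show o: "over (X \<inter> {len q..}) E F" by (rule over_mono[OF r(2)]) (use YX far(1) in auto)
  show "r \<sqsubseteq> P" using r(1) qP by (rule below_trans)
  show "anchored \<psi> c d r F" using anch r(1) o r(3) by (rule anchored_mono)
  show "rich c r Y" using rich_mono[OF rich_mirrored[OF subset_refl infY] r(1)] .
qed

lemma reaches_over:
  assumes "reaches r F" "r' \<sqsubseteq> r" "over (Y \<inter> {len r..}) F F'" "good e c r' F'"
  shows "reaches r' F'"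
  unfolding reaches_def
proof (intro conjI assms(4))
  show "r' \<sqsubseteq> q" using assms(2) reachesD(1)[OF assms(1)] by (rule below_trans)
  show "over Y E F'"
    using reachesD(2)[OF assms(1)] over_mono[OF assms(3) Int_lower1] by (rule over_trans)
qed

lemma printed_mono:
  assumes "printed s r F" "r' \<sqsubseteq> r" "over (Y \<inter> {len r..}) F F'"
  shows "printed s r' F'"
proof -
  obtain k where k: "k \<in> F - E" "odd k = s" "z (k div 2) < len r" "computes \<psi> (2 * len r) F (z (k div 2))"
    using assms(1) unfolding printed_def by blast
  have "z (k div 2) < len r'" using k(3) below_len[OF assms(2)] by simp
  then show ?thesis
    using k computes_over[OF k(4) assms(3) below_len[OF assms(2)]] over_subset[OF assms(3)]
    unfolding printed_def by blast
qed

text \<open>If they differed, \<open>z x\<close> could be promised \<open>d\<close> and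
  \<open>\<zeta> x\<close> promised \<open>\<not> d\<close>: the mirror then allows limit
  \<open>c\<close> at \<open>x\<close>, whereas \<open>promise_link\<close> demands \<open>d\<close>
  at \<open>\<zeta> x\<close>.\<close>

lemma promised_is_mirror:
  assumes r: "reaches r F" and rd: "ready \<psi> Y F s Y' \<zeta>" and x: "x \<in> Y'"
    and big: "len r \<le> x" "len r \<le> z x" "len r \<le> \<zeta> x"
  shows "\<zeta> x = z x"
proof (rule ccontr)
  assume neq: "\<zeta> x \<noteq> z x"
  have xY: "x \<in> Y" "often X (insert (tag s x) F) (prints \<psi> (\<zeta> x))"
    using rd x unfolding ready_def by blast+
  obtain t where t: "t \<sqsubseteq> r" "Suc (max (z x) (\<zeta> x)) \<le> len t"
    "\<And>v. len r \<le> v \<Longrightarrow> lm t v = (if v = z x then d else \<not> d)"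
    using lengthen[of r "Suc (max (z x) (\<zeta> x))" "\<lambda>v. if v = z x then d else \<not> d"] by blast
  have "\<exists>t'. t' \<sqsubseteq> t \<and> (\<forall>y\<in>{x}. lims e t' y c)"
    by (rule settle_mirrored[OF _ below_trans[OF t(1) reachesD(1)[OF r]]])
      (use t(2,3) big xY in auto)
  then obtain t' where t': "t' \<sqsubseteq> t" "lims e t' x c" by blast
  have lt: "\<zeta> x < len t" using t(2) by simp
  have "lm t' (\<zeta> x) = d"
  proof (rule promise_link[OF reachesD(6)[OF r] reachesD(7)[OF r] YX _ big(1) xY(2) big(3)])
    show "x \<in> X" using xY(1) YX by blast
    show "t' \<sqsubseteq> r" using t'(1) t(1) by (rule below_trans)
    show "\<zeta> x < len t'" using lt below_len[OF t'(1)] by simp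
  qed (rule t'(2))
  then show False using below_lm[OF t'(1) lt] t(3)[OF big(3)] neq by simp
qed

lemma ready_element:
  assumes r: "reaches r F" and rd: "ready \<psi> Y F s Y' \<zeta>"
  obtains x where "x \<in> Y" "n \<le> x" "n \<le> z x" "often X (insert (tag s x) F) (prints \<psi> (z x))"
proof -
  have Y': "Y' \<subseteq> Y" "infinite Y'" "inj_on \<zeta> Y'" "\<And>x. x \<in> Y' \<Longrightarrow> often X (insert (tag s x) F) (prints \<psi> (\<zeta> x))"
    using rd unfolding ready_def by blast+
  let ?n = "max n (len r)"
  let ?Y1 = "{x \<in> Y'. ?n \<le> x \<and> ?n \<le> \<zeta> x}"
  have "infinite ?Y1" using Y'(2,3) by (rule infinite_trim)
  moreover have "inj_on z ?Y1" by (rule inj_on_subset[OF inj]) (use Y'(1) in blast)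
  ultimately have "infinite {x \<in> ?Y1. ?n \<le> x \<and> ?n \<le> z x}" by (rule infinite_trim)
  then obtain x where "x \<in> {x \<in> ?Y1. ?n \<le> x \<and> ?n \<le> z x}" using infinite_natD by blast
  then have x: "x \<in> Y'" "?n \<le> x" "?n \<le> \<zeta> x" "?n \<le> z x" by auto
  have "\<zeta> x = z x" by (rule promised_is_mirror[OF r rd x(1)]) (use x in auto)
  have "often X (insert (tag s x) F) (prints \<psi> (z x))"
    using Y'(4)[OF x(1)] \<open>\<zeta> x = z x\<close> by simp
  then show thesis using that[of x] Y'(1) x by auto
qed

text \<open>The limit of \<open>z1\<close> is held at the wrong value until an element \<open>x2\<close> on the side of \<open>x1\<close> has
  been chosen, which makes the color of the printed pair \<open>z1, z (x2)\<close> wrong; meanwhile only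
  \<open>x1\<close> has its limit disturbed, and no pair on one side has to be homogeneous.\<close>

lemma not_printed_ready:
  assumes r: "reaches r F" and rd: "ready \<psi> Y F s Y' \<zeta>"
    and zF: "\<And>k. k \<in> F - E \<Longrightarrow> z (k div 2) < len r"
  shows "\<not> printed s r F"
proof
  assume "printed s r F"
  then obtain k1 where k1: "k1 \<in> F" "k1 \<notin> E" "odd k1 = s" and
    comp1: "computes \<psi> (2 * len r) F (z (k1 div 2))"
    unfolding printed_def by blast
  define x1 z1 where "x1 = k1 div 2" and "z1 = z x1"
  note rq = reachesD(1)[OF r] and gF = reachesD(4)[OF r] and overF = reachesD(2)[OF r]
  have numY: "k div 2 \<in> Y" if "k \<in> F - E" for k using over_new[OF overF] that by blast
  have x1: "x1 \<in> Y" using numY k1 by (simp add: x1_def)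
  have z1: "len q \<le> z1" "z1 < len r" using far(2)[OF x1] zF k1 by (auto simp: z1_def x1_def)
  have mirror_d: "lm r (z (k div 2)) = d" if "k \<in> F - E" for k
    using reflect[OF rq numY[OF that] good_lims[OF gF] zF[OF that]] that by blast
  \<comment> \<open>The promise at \<open>z1\<close> is revised to the wrong value;
    \<open>r1\<close> is still below \<open>q\<close> but no longer below \<open>r\<close>.\<close>
  define r1 where "r1 = flip r z1 (\<not> d)"
  have r1q: "r1 \<sqsubseteq> q" unfolding r1_def using rq z1(1) by (rule flip_below)
  \<comment> \<open>The remaining new elements: by injectivity of \<open>z\<close> their promises
    are untouched, so their limits can be forced again.\<close>
  define S where "S = (\<lambda>k. k div 2) ` (F - E) - {x1}"
  have S: "x \<in> Y" "z x < len r" "lm r (z x) = d" "z x \<noteq> z1" if "x \<in> S" for x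
  proof -
    obtain k where k: "k \<in> F - E" "x = k div 2" "x \<noteq> x1" using \<open>x \<in> S\<close> unfolding S_def by blast
    show "x \<in> Y" "z x < len r" "lm r (z x) = d" using numY zF mirror_d k(1,2) by auto
    then show "z x \<noteq> z1" using inj_onD[OF inj, of x x1] x1 k(3) by (auto simp: z1_def)
  qed
  have finS: "finite S" using good_finite[OF gF] by (simp add: S_def)
  have "\<exists>r2. r2 \<sqsubseteq> r1 \<and> (\<forall>x\<in>S. lims e r2 x c)"
    by (rule settle_mirrored[OF finS r1q]) (use S in \<open>simp add: r1_def\<close>)
  then obtain r2 where r2: "r2 \<sqsubseteq> r1" "\<And>x. x \<in> S \<Longrightarrow> lims e r2 x c" by blast
  have r2q: "r2 \<sqsubseteq> q" using r2(1) r1q by (rule below_trans)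
  have r2P: "r2 \<sqsubseteq> P" using r2q qP by (rule below_trans)
  have len_r2: "len r \<le> len r2" using below_len[OF r2(1)] by (simp add: r1_def)
  obtain x2 where x2: "x2 \<in> Y" "len r2 \<le> x2" "len r2 \<le> z x2"
    and often2: "often X (insert (tag s x2) F) (prints \<psi> (z x2))"
    using ready_element[OF r rd, of "len r2"] by blast
  define z2 where "z2 = z x2"
  have z12: "z1 < z2" using z1(2) len_r2 x2(3) by (simp add: z2_def)
  obtain r3 where r3: "r3 \<sqsubseteq> r2" "Suc z2 \<le> len r3" "\<And>v. len r2 \<le> v \<Longrightarrow> lm r3 v = d"
    using lengthen[of r2 "Suc z2" "\<lambda>_. d"] by blast
  have lims2: "\<forall>y\<in>(\<lambda>k. k div 2) ` F - {x1}. lims e r2 y c"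
  proof
    fix y assume "y \<in> (\<lambda>k. k div 2) ` F - {x1}"
    then obtain k where k: "k \<in> F" "y = k div 2" "y \<noteq> x1" by blast
    show "lims e r2 y c"
    proof (cases "k \<in> E")
      case True
      then show ?thesis using lims_mono[OF good_lims[OF anchored_good[OF anch]] r2q] k(2) by blast
    next
      case False
      then show ?thesis using r2(2) k unfolding S_def by blast
    qed
  qed
  have "finite ((\<lambda>k. k div 2) ` F - {x1})" using good_finite[OF gF] by simp
  \<comment> \<open>Pairs of \<open>x2\<close> with all stem elements except \<open>x1\<close>
    receive color \<open>c\<close>; the pair with \<open>x1\<close> is not constrained, since both
    are on side \<open>s\<close>.\<close>
  then obtain r4 where r4: "r4 \<sqsubseteq> r3" "\<And>y. y \<in> (\<lambda>k. k div 2) ` F - {x1} \<Longrightarrow> decides e r4 y x2 c"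
    using lims_decides[OF _ lims2 r3(1) x2(2) r2P] by blast
  have r4r2: "r4 \<sqsubseteq> r2" using r4(1) r3(1) by (rule below_trans)
  have r4r1: "r4 \<sqsubseteq> r1" using r4r2 r2(1) by (rule below_trans)
  have z2r4: "z2 < len r4" using r3(2) below_len[OF r4(1)] by simp
  have wrong: "pt r4 z1 z2 = (\<not> d)"
  proof -
    have "pt r4 z1 z2 = lm r1 z1"
      by (rule below_pt_lm[OF r4r1]) (use z1(2) x2(3) len_r2 z2r4 in \<open>auto simp: r1_def z2_def\<close>)
    then show ?thesis by (simp add: r1_def)
  qed
  \<comment> \<open>The right promise returns while all colors stay. Decided values depend on
    \<open>pt\<close> only and survive; limits have to be forced anew, which the mirror
    permits.\<close>
  define r5 where "r5 = flip r4 z1 d"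
  have r5q: "r5 \<sqsubseteq> q" unfolding r5_def using below_trans[OF r4r1 r1q] z1(1) by (rule flip_below)
  have len_r5: "len r \<le> len r5" using below_len[OF r4r2] len_r2 by (simp add: r5_def)
  have "\<exists>r6. r6 \<sqsubseteq> r5 \<and> (\<forall>x\<in>insert x1 (insert x2 S). lims e r6 x c)"
  proof (rule settle_mirrored[OF _ r5q])
    fix x assume "x \<in> insert x1 (insert x2 S)"
    then consider "x = x1" | "x = x2" | "x \<in> S" by blast
    then show "x \<in> Y \<and> z x < len r5 \<and> lm r5 (z x) = d"
    proof cases
      case 1
      then show ?thesis using x1 z1(2) len_r5 by (simp add: r5_def z1_def)
    next
      case 2
      have "lm r4 z2 = d" using below_lm[OF r4(1), of z2] r3(2,3) x2(3) by (simp add: z2_def)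
      then show ?thesis using 2 x2(1) z2r4 by (simp add: r5_def z2_def)
    next
      case 3
      then have "lm r4 (z x) = d" using below_lm[OF r4r1, of "z x"] S by (simp add: r1_def)
      then show ?thesis using S[OF 3] len_r5 by (simp add: r5_def)
    qed
  qed (use finS in simp)
  then obtain r6 where r6: "r6 \<sqsubseteq> r5" "\<And>x. x \<in> insert x1 (insert x2 S) \<Longrightarrow> lims e r6 x c" by blast
  have r6q: "r6 \<sqsubseteq> q" using r6(1) r5q by (rule below_trans)
  have len_r6: "len r \<le> len r6" using len_r5 below_len[OF r6(1)] by simp
  have transfer: "decides e r6 x y c" if "decides e r4 x y c" for x y
    using that decides_cong[of r5 r4 e] decides_mono[OF _ r6(1)] by (simp add: r5_def)
  have transfer': "decides e r6 x y c" if "decides e r x y c" for x y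
    using that decides_cong[of r1 r e] decides_mono[OF _ r4r1] transfer by (simp add: r1_def)
  let ?F = "insert (tag s x2) F"
  have small: "k < tag s x2 \<and> k div 2 < x2" if "k \<in> F" for k
  proof -
    have "k < 2 * x2" using good_less[OF gF that] len_r2 x2(2) by simp
    then show ?thesis using tag_ge(2)[of x2 s] by auto
  qed
  have good6: "good e c r6 ?F"
    unfolding good_def
  proof (intro conjI)
    show "finite ?F" using good_finite[OF gF] by simp
    show "inj_on (\<lambda>k. k div 2) ?F" using good_inj[OF gF] small by (auto simp: inj_on_def)
    show lims6: "\<forall>k\<in>?F. lims e r6 (k div 2) c"
    proof
      fix k assume "k \<in> ?F"
      then consider "k = tag s x2" | "k \<in> E" | "k \<in> F - E" by blast
      then show "lims e r6 (k div 2) c"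
      proof cases
        case 2
        then show ?thesis using lims_mono[OF good_lims[OF anchored_good[OF anch]] r6q] by blast
      next
        case 3
        then have "k div 2 \<in> insert x1 (insert x2 S)" unfolding S_def by blast
        then show ?thesis by (rule r6(2))
      qed (use r6(2) in simp)
    qed
    then show "?F \<subseteq> {..<2 * len r6}" using lims_len div2_less_iff by blast
    show "\<forall>j\<in>?F. \<forall>k\<in>?F. j < k \<and> odd j \<noteq> odd k \<longrightarrow> decides e r6 (j div 2) (k div 2) c"
    proof (intro ballI impI)
      fix j k assume j: "j \<in> ?F" and k: "k \<in> ?F" and jk: "j < k \<and> odd j \<noteq> odd k"
      have jF: "j \<in> F" using j k jk small by (metis insertE less_asym less_irrefl)
      show "decides e r6 (j div 2) (k div 2) c"
      proof (cases "k \<in> F")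
        case True
        then show ?thesis using good_decides[OF gF jF] jk transfer' by blast
      next
        case False
        then have k2: "k = tag s x2" using k by blast
        then have "odd j \<noteq> odd k1" using jk k1(3) by simp
        then have "j div 2 \<noteq> x1"
          using inj_onD[OF good_inj[OF gF], of j k1] jF k1(1) by (auto simp: x1_def)
        then show ?thesis using r4(2)[of "j div 2"] jF transfer k2 by simp
      qed
    qed
  qed
  have over2: "over (Y \<inter> {len r..}) F ?F"
    using good_inj[OF good6] good_finite[OF gF] x2(1,2) len_r2 by (intro over_insert) auto
  have "reaches r6 ?F"
    unfolding reaches_def using r6q good6 over_trans[OF overF over_mono[OF over2 Int_lower1]] by blast
  note R = reachesD[OF this]
  \<comment> \<open>With both \<open>z1\<close> and \<open>z2\<close> printed, being anchored
    demands color \<open>d\<close> for a pair already colored \<open>\<not> d\<close>.\<close>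
  obtain r7 F7 where r7: "r7 \<sqsubseteq> r6" "good e c r7 F7" "over (Y \<inter> {len r6..}) ?F F7"
    "computes \<psi> (2 * len r7) F7 z2"
    using realize_computes[OF R(5,4,7) often_mono[OF often2 YX]] unfolding z2_def by blast
  have overF7: "over (Y \<inter> {len r..}) F F7"
    using over_step[OF over2 r7(3) subset_refl len_r6] .
  have "computes \<psi> (2 * len r7) F7 z1"
    using computes_over[OF comp1 overF7] len_r6 below_len[OF r7(1)] by (simp add: z1_def x1_def)
  moreover have "z2 < len r7"
    using z2r4 below_len[OF r6(1)] below_len[OF r7(1)] by (simp add: r5_def)
  moreover have "over (X \<inter> {len q..}) E F7"
    using over_step[OF R(3) r7(3) YX below_len[OF r6q]] .
  ultimately have "pt r7 z1 z2 = d"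
    using anchoredD(3)[OF anch below_trans[OF r7(1) r6q] _ r7(2) z1(1) z12 _ _ r7(4)] by blast
  moreover have "pt r7 z1 z2 = pt r5 z1 z2"
    by (rule below_pt[OF below_trans[OF r7(1) r6(1)] z12]) (use z2r4 in \<open>simp add: r5_def\<close>)
  ultimately show False using wrong by (simp add: r5_def)
qed

text \<open>A ready extension exists, and by \<open>not_printed_ready\<close> its side
  \<open>s\<close> has not been printed. A suitable \<open>x\<close> is then given limit
  \<open>c\<close>, added on that side, and its mirror \<open>z x\<close> is printed.\<close>

lemma printed_next:
  assumes "reaches r F"
  obtains r' F' s where "reaches r' F'" "printed s r' F'" "\<not> printed s r F"
    "\<forall>s'. printed s' r F \<longrightarrow> printed s' r' F'"
proof -
  note R = reachesD[OF assms]
  obtain r0 F1 s Y' \<zeta> where r0: "r0 \<sqsubseteq> r" "over (Y \<inter> {len r..}) F F1" "good e c r0 F1"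
    and rd: "ready \<psi> Y F1 s Y' \<zeta>"
    using ready_exists[OF R(6) YX R(7)] by blast
  define N where "N = Suc (Max (insert 0 ((\<lambda>k. z (k div 2)) ` F1)))"
  obtain r1 where r1: "r1 \<sqsubseteq> r0" "N \<le> len r1" using lengthen[of r0 N] by blast
  have zF1: "z (k div 2) < len r1" if "k \<in> F1 - E" for k
  proof -
    have "z (k div 2) \<le> Max (insert 0 ((\<lambda>k. z (k div 2)) ` F1))"
      using that good_finite[OF r0(3)] by (intro Max_ge) auto
    then show ?thesis using r1(2) by (simp add: N_def)
  qed
  have r1r: "r1 \<sqsubseteq> r" using r1(1) r0(1) by (rule below_trans)
  have reach1: "reaches r1 F1"
    using reaches_over[OF assms r1r r0(2) good_mono[OF r0(3) r1(1)]] .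
  note R1 = reachesD[OF reach1]
  have not: "\<not> printed s r1 F1" using not_printed_ready[OF reach1 rd zF1] .
  obtain x where x: "x \<in> Y" "len r1 \<le> x" "len r1 \<le> z x"
    and often: "often X (insert (tag s x) F1) (prints \<psi> (z x))"
    using ready_element[OF reach1 rd, of "len r1"] by blast
  obtain t where t: "t \<sqsubseteq> r1" "Suc (z x) \<le> len t" "\<And>v. len r1 \<le> v \<Longrightarrow> lm t v = d"
    using lengthen[of r1 "Suc (z x)" "\<lambda>_. d"] by blast
  have "\<exists>t'. t' \<sqsubseteq> t \<and> (\<forall>y\<in>{x}. lims e t' y c)"
    by (rule settle_mirrored[OF _ below_trans[OF t(1) R1(1)]]) (use t(2,3) x in auto)
  then obtain t' where t': "t' \<sqsubseteq> t" "lims e t' x c" by blast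
  have t'r1: "t' \<sqsubseteq> r1" using t'(1) t(1) by (rule below_trans)
  obtain r2 where r2: "r2 \<sqsubseteq> t'" "good e c r2 (insert (tag s x) F1)"
    using good_insert[OF R1(5,4) t'r1 x(2) t'(2)] by blast
  have r2r1: "r2 \<sqsubseteq> r1" using r2(1) t'r1 by (rule below_trans)
  have over2: "over (Y \<inter> {len r1..}) F1 (insert (tag s x) F1)"
    using good_inj[OF r2(2)] good_finite[OF r0(3)] x(1,2) by (intro over_insert) auto
  have reach2: "reaches r2 (insert (tag s x) F1)"
    using reaches_over[OF reach1 r2r1 over2 r2(2)] .
  note R2 = reachesD[OF reach2]
  obtain r3 F3 where r3: "r3 \<sqsubseteq> r2" "good e c r3 F3" "over (Y \<inter> {len r2..}) (insert (tag s x) F1) F3"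
    "Suc (z x) \<le> len r3" "computes \<psi> (2 * len r3) F3 (z x)"
    using realize_computes[OF R2(5,4,7) often_mono[OF often YX], of "Suc (z x)"] by blast
  have reach3: "reaches r3 F3" using reaches_over[OF reach2 r3(1,3,2)] .
  have "tag s x \<in> F3" using over_subset[OF r3(3)] by blast
  moreover have "tag s x \<notin> E"
    using good_less[OF anchored_good[OF anch], of "tag s x"] far(1)[OF x(1)] tag_ge(2)[of x s] by auto
  ultimately have "printed s r3 F3"
    using r3(4,5) unfolding printed_def by (intro bexI[of _ "tag s x"]) auto
  moreover have "printed s' r3 F3" if "printed s' r F" for s'
    using printed_mono[OF printed_mono[OF printed_mono[OF that r1r r0(2)] r2r1 over2] r3(1,3)] .
  moreover have "\<not> printed s r F" using not printed_mono[OF _ r1r r0(2)] by blast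
  ultimately show thesis using that reach3 by blast
qed

text \<open>Each round prints an element from a side that had none before, but there are only two sides.\<close>

lemma contradiction: False
proof -
  note g = anchored_good[OF anch]
  have "reaches q E"
    unfolding reaches_def using over_refl[OF good_finite[OF g] good_inj[OF g]] g by simp
  then obtain r1 F1 s1 where 1: "reaches r1 F1" "printed s1 r1 F1" by (rule printed_next)
  from 1(1) obtain r2 F2 s2 where 2: "reaches r2 F2" "printed s2 r2 F2" "\<not> printed s2 r1 F1"
    "\<forall>s. printed s r1 F1 \<longrightarrow> printed s r2 F2" by (rule printed_next)
  from 2(1) obtain s3 where "\<not> printed s3 r2 F2" by (rule printed_next)
  moreover have "s1 \<noteq> s2" using 1(2) 2(3) by blast
  ultimately show False using 2(2) 2(4)[rule_format, OF 1(2)] by (cases s3; cases s1; cases s2) auto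
qed

end

section \<open>Some color is not stuck\<close>

context forcing
begin

text \<open>Were both colors stuck everywhere, there would be a link for \<open>False\<close> and,
  inside it, one for \<open>True\<close>. Together they form a mirror, which refutes both
  alternatives left for \<open>False\<close>.\<close>

lemma dens_exists: "\<exists>q c. q \<sqsubseteq> P \<and> dens e X c q"
proof (rule ccontr)
  assume "\<not> ?thesis"
  then have nd: "\<And>q c. q \<sqsubseteq> P \<Longrightarrow> \<not> dens e X c q" by blast
  have infX: "infinite X" using res by (simp add: reservoir_def)
  obtain r0 Y0 z0 d0 where r0: "r0 \<sqsubseteq> P" "Y0 \<subseteq> X" "linked False d0 r0 Y0 z0"
    and alt: "(\<forall>r' x. r' \<sqsubseteq> r0 \<and> x \<in> Y0 \<longrightarrow> \<not> lims e r' x False) \<or> (\<exists>\<psi> E. anchored \<psi> False d0 r0 E)"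
    by (rule linked_exists[OF below_refl nd[OF below_refl] subset_refl infX])
  obtain r1 Y1 z1 d1 where r1: "r1 \<sqsubseteq> r0" "Y1 \<subseteq> Y0" "linked True d1 r1 Y1 z1"
    by (rule linked_exists[OF r0(1) nd[OF r0(1)] r0(2) linkedD(1)[OF r0(3)]])
  have r1P: "r1 \<sqsubseteq> P" using r1(1) r0(1) by (rule below_trans)
  define Y where "Y = {x \<in> Y1. len r1 \<le> x \<and> len r1 \<le> z0 x}"
  have l0: "linked False d0 r1 Y z0"
    unfolding Y_def using linked_trim[OF r0(3) r1(1,2) linkedD(1)[OF r1(3)]] .
  have YY1: "Y \<subseteq> Y1" by (auto simp: Y_def)
  have eq: "z1 x = z0 x \<and> d1 = (\<not> d0)" if x: "x \<in> Y" for x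
  proof (rule ccontr)
    assume neq: "\<not> ?thesis"
    define N where "N = Suc (max (z0 x) (z1 x))"
    \<comment> \<open>Wrong values for both links at once: unless \<open>z1 x = z0 x\<close> and
      \<open>d0\<close>, \<open>d1\<close> are opposite, \<open>x\<close> could have neither limit,
      against \<open>settle\<close>.\<close>
    obtain t where t: "t \<sqsubseteq> r1" "N \<le> len t"
      "\<And>v. len r1 \<le> v \<Longrightarrow> lm t v = (if v = z0 x then \<not> d0 else \<not> d1)"
      using lengthen[of r1 N "\<lambda>v. if v = z0 x then \<not> d0 else \<not> d1"] by blast
    have lt: "z0 x < len t" "z1 x < len t" using t(2) by (auto simp: N_def)
    have far: "len r1 \<le> z0 x" "len r1 \<le> z1 x"
      using linkedD(4)[OF l0 x] linkedD(4)[OF r1(3)] x YY1 by auto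
    obtain t' c where t': "t' \<sqsubseteq> t" "lims e t' x c" using settle below_trans[OF t(1) r1P] by blast
    have t'r1: "t' \<sqsubseteq> r1" using t'(1) t(1) by (rule below_trans)
    have lt': "z0 x < len t'" "z1 x < len t'" using lt below_len[OF t'(1)] by auto
    have lm: "lm t' (z0 x) = (\<not> d0)" "lm t' (z1 x) = (if z1 x = z0 x then \<not> d0 else \<not> d1)"
      using below_lm[OF t'(1)] lt t(3) far by auto
    show False
    proof (cases c)
      case True
      then have "lm t' (z1 x) = d1" using linkedD(5)[OF r1(3) t'r1] x YY1 t'(2) lt'(2) by auto
      then show False using lm(2) neq by (auto split: if_splits)
    next
      case False
      then have "lm t' (z0 x) = d0" using linkedD(5)[OF l0 t'r1 x] t'(2) lt'(1) by auto
      then show False using lm(1) by simp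
    qed
  qed
  interpret mirror e X P False d0 r1 Y z0
  proof
    show "r1 \<sqsubseteq> P" by fact
    show "infinite Y" "inj_on z0 Y" using linkedD(1,2)[OF l0] by blast+
    show "Y \<subseteq> X" using YY1 r1(2) r0(2) by blast
    show "len r1 \<le> x" "len r1 \<le> z0 x" if "x \<in> Y" for x using linkedD(3,4)[OF l0 that] .
    fix r x c' assume r: "r \<sqsubseteq> r1" "x \<in> Y" "lims e r x c'" "z0 x < len r"
    show "lm r (z0 x) = d0 \<longleftrightarrow> c' = False"
    proof (cases c')
      case True
      moreover have "x \<in> Y1" using r(2) YY1 by blast
      ultimately have "lm r (z1 x) = d1"
        using linkedD(5)[OF r1(3) r(1), of x] r(3,4) eq[OF r(2)] by simp
      then show ?thesis using eq[OF r(2)] True by auto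
    next
      case False
      then show ?thesis using linkedD(5)[OF l0 r(1,2)] r(3,4) by auto
    qed
  qed
  from alt show False
  proof (elim disjE exE)
    assume vac: "\<forall>r' x. r' \<sqsubseteq> r0 \<and> x \<in> Y0 \<longrightarrow> \<not> lims e r' x False"
    obtain r' x where "r' \<sqsubseteq> r1" "x \<in> Y" "lims e r' x False"
      using rich_mirrored[OF subset_refl infY, unfolded rich_def, rule_format, OF below_refl] by blast
    then show False using vac below_trans[OF _ r1(1)] YY1 r1(2) by blast
  next
    fix \<psi> E assume "anchored \<psi> False d0 r0 E"
    then have "anchored \<psi> False d0 r1 E" using r1(1) by (rule anchored_below)
    then interpret anchored_mirror e X P False d0 r1 Y z0 \<psi> E by unfold_locales
    show False by (rule contradiction)
  qed
qed

end

subsection \<open>Generic colorings\<close>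

lemma antimono_below:
  assumes "\<And>n. Q (Suc n) \<sqsubseteq> Q n" "n \<le> m"
  shows "Q m \<sqsubseteq> Q n"
  using assms(2)
proof (induction m rule: dec_induct)
  case (step m)
  then show ?case using below_trans[OF assms(1)] by blast
qed simp

text \<open>A descending sequence passes through countably many dense sets. The coloring is read off
  its finite parts and is stable because every number eventually receives a promised limit.\<close>

lemma generic_coloring:
  assumes "countable \<D>" and dense: "\<And>D q. D \<in> \<D> \<Longrightarrow> \<exists>r. r \<sqsubseteq> q \<and> r \<in> D"
  obtains Q f where "\<And>m n. n \<le> m \<Longrightarrow> Q m \<sqsubseteq> Q n" "\<And>n. n \<le> len (Q n)"
    "\<And>D. D \<in> \<D> \<Longrightarrow> \<exists>n. Q n \<in> D"
    "\<And>n x y. x < y \<Longrightarrow> y < len (Q n) \<Longrightarrow> f x y = pt (Q n) x y" "stable f"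
proof -
  \<comment> \<open>Adding the dense set \<open>UNIV\<close> guarantees a nonempty family to
    enumerate.\<close>
  define D where "D = from_nat_into (insert UNIV \<D>)"
  have D: "range D = insert UNIV \<D>" unfolding D_def using assms(1) by (intro range_from_nat_into) auto
  have dense': "\<exists>r. r \<sqsubseteq> q \<and> r \<in> D n" for n q
  proof -
    have "D n \<in> insert UNIV \<D>" using D by blast
    then show ?thesis using dense by (metis UNIV_I below_refl insertE)
  qed
  have "\<exists>Q. \<forall>n. n \<le> len (Q n) \<and> (Q (Suc n) \<sqsubseteq> Q n \<and> Q (Suc n) \<in> D n)"
  proof (rule dependent_nat_choice)
    fix q n
    obtain r where r: "r \<sqsubseteq> q" "Suc n \<le> len r" using lengthen[of q "Suc n"] by blast
    obtain s where s: "s \<sqsubseteq> r" "s \<in> D n" using dense' by blast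
    show "\<exists>r. Suc n \<le> len r \<and> r \<sqsubseteq> q \<and> r \<in> D n"
      using below_trans[OF s(1) r(1)] s(2) order_trans[OF r(2) below_len[OF s(1)]] by blast
  qed simp
  then obtain Q where Q: "\<And>n. n \<le> len (Q n)" "\<And>n. Q (Suc n) \<sqsubseteq> Q n" "\<And>n. Q (Suc n) \<in> D n"
    by metis
  have anti: "n \<le> m \<Longrightarrow> Q m \<sqsubseteq> Q n" for m n using Q(2) by (rule antimono_below)
  \<comment> \<open>The index \<open>Suc y\<close> suffices since \<open>len (Q (Suc y))\<close>
    exceeds \<open>y\<close>.\<close>
  define f where "f x y = pt (Q (Suc y)) x y" for x y
  have f: "f x y = pt (Q n) x y" if "x < y" "y < len (Q n)" for n x y
  proof (cases "Suc y \<le> n")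
    case True
    have "y < len (Q (Suc y))" using Q(1)[of "Suc y"] by simp
    then show ?thesis using below_pt[OF anti[OF True] that(1)] by (simp add: f_def)
  next
    case False
    then show ?thesis using below_pt[OF anti[of n "Suc y"] that] by (simp add: f_def)
  qed
  show thesis
  proof (rule that[OF anti Q(1) _ f])
    fix C assume "C \<in> \<D>"
    then obtain n where "C = D n" using D by (metis insertI2 rangeE)
    then show "\<exists>n. Q n \<in> C" using Q(3) by blast
  next
    show "stable f"
      unfolding stable_def
    proof
      fix x
      let ?n = "Suc x"
      have x: "x < len (Q ?n)" using Q(1)[of ?n] by simp
      have "col f x u = lm (Q ?n) x" if u: "len (Q ?n) < u" for u
      proof -
        let ?m = "max ?n (Suc u)"
        have um: "u < len (Q ?m)" using Q(1)[of ?m] by simp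
        have "col f x u = f x u" using x u by (simp add: col_def)
        also have "\<dots> = pt (Q ?m) x u" using x u um by (intro f) auto
        also have "\<dots> = lm (Q ?n) x"
          by (rule below_pt_lm[OF anti x _ um]) (use u in auto)
        finally show ?thesis .
      qed
      then show "\<exists>c N. \<forall>u>N. col f x u = c" by blast
    qed
  qed
qed

lemma dens_mono: "dens e X c q \<Longrightarrow> r \<sqsubseteq> q \<Longrightarrow> dens e X c r"
  unfolding dens_def using below_trans[of _ r q] by auto

lemma win_mono:
  assumes "win X \<psi> q E" "r \<sqsubseteq> q"
  shows "win X \<psi> r E"
  using assms(1)[unfolded win_def]
proof (elim disjE exE conjE)
  fix a b a' b' assume *: "a < b" "b < len q" "a' < b'" "b' < len q" "pt q a b \<noteq> pt q a' b'"
    "\<forall>w\<in>{a, b, a', b'}. computes \<psi> (2 * len q) E w"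
  have "computes \<psi> (2 * len r) E w" if "w \<in> {a, b, a', b'}" for w
  proof (rule computes_mono)
    show "computes \<psi> (2 * len q) E w" using *(6) that by blast
  qed (use below_len[OF assms(2)] in simp_all)
  then show ?thesis
    using *(1-5) below_len[OF assms(2)] below_pt[OF assms(2) *(1,2)] below_pt[OF assms(2) *(3,4)]
    by (intro winI[of a b r a' b']) simp_all
next
  fix n assume *: "\<forall>E'. over (X \<inter> {len q..}) E E' \<longrightarrow> \<not> prints_from \<psi> n E'"
  have "X \<inter> {len r..} \<subseteq> X \<inter> {len q..}" using below_len[OF assms(2)] by auto
  then show ?thesis using * over_mono unfolding win_def by blast
qed

lemma meets_mono: "meets X t q E \<Longrightarrow> r \<sqsubseteq> q \<Longrightarrow> meets X t r E"
  unfolding meets_def using win_mono by (cases t) auto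

section \<open>Dense sets for the generic sequence\<close>

definition total_or_not :: "recf \<Rightarrow> cond set" where
  "total_or_not e = {q. (\<exists>x y. x < y \<and> (\<forall>r c. r \<sqsubseteq> q \<longrightarrow> \<not> decides e r x y c)) \<or> total e q}"

definition settles_or_not :: "recf \<Rightarrow> cond set" where
  "settles_or_not e = {q. (\<exists>x. \<forall>r c. r \<sqsubseteq> q \<longrightarrow> \<not> lims e r x c) \<or> settles e q}"

text \<open>If the computed coloring has limit \<open>\<not> c\<close> at \<open>x\<close>, the
  first alternative fails for large \<open>N\<close>, and the second yields
  \<open>lims\<close>.\<close>

definition moves_or_not :: "recf \<times> nat \<times> bool \<times> nat \<Rightarrow> cond set" where
  "moves_or_not = (\<lambda>(e, x, c, N). {q. (\<exists>y\<ge>N. decides e q x y c)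
     \<or> (\<forall>r y. r \<sqsubseteq> q \<and> N \<le> y \<longrightarrow> \<not> decides e r x y c)})"

definition dens_or_not :: "nat set \<Rightarrow> recf \<Rightarrow> cond set" where
  "dens_or_not X e = {q. (\<exists>c. dens e X c q) \<or> (\<forall>r. r \<sqsubseteq> q \<longrightarrow> \<not> (total e r \<and> settles e r))}"

text \<open>Stems are indexed by lists to keep the family countable.\<close>

definition meets_or_not ::
  "nat set \<Rightarrow> recf \<times> bool \<times> nat list \<times> (recf + nat \<times> bool) \<times> nat \<Rightarrow> cond set" where
  "meets_or_not X = (\<lambda>(e, c, l, t, N).
     {q. (\<exists>E'. over (X \<inter> {N..}) (set l) E' \<and> good e c q E' \<and> meets X t q E')
       \<or> (\<forall>r. r \<sqsubseteq> q \<longrightarrow> \<not> (good e c r (set l) \<and> dens e X c r))})"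

definition requirements :: "nat set \<Rightarrow> cond set set" where
  "requirements X = range total_or_not \<union> range settles_or_not \<union> range moves_or_not
     \<union> range (dens_or_not X) \<union> range (meets_or_not X)"

lemma in_requirements:
  "total_or_not e \<in> requirements X" "settles_or_not e \<in> requirements X"
  "moves_or_not i \<in> requirements X" "dens_or_not X e \<in> requirements X"
  "meets_or_not X j \<in> requirements X"
  by (simp_all add: requirements_def)

lemma countable_requirements: "countable (requirements X)"
  unfolding requirements_def by (intro countable_Un countable_image countableI_type)

text \<open>Each set asks for an event or for its exclusion by all extensions, so either some
  extension qualifies or \<open>q\<close> itself does. For \<open>dens_or_not\<close> the event is
  supplied by \<open>dens_exists\<close>.\<close>

lemma requirements_dense:
  assumes "reservoir X" "D \<in> requirements X"
  shows "\<exists>r. r \<sqsubseteq> q \<and> r \<in> D"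
proof -
  consider e where "D = total_or_not e" | e where "D = settles_or_not e"
    | e x c N where "D = moves_or_not (e, x, c, N)" | e where "D = dens_or_not X e"
    | e c l t N where "D = meets_or_not X (e, c, l, t, N)"
    using assms(2) unfolding requirements_def by fast
  then show ?thesis
  proof cases
    case (1 e)
    show ?thesis
    proof (cases "total e q")
      case False
      then obtain r x y where "r \<sqsubseteq> q" "x < y" "\<forall>r' c. r' \<sqsubseteq> r \<longrightarrow> \<not> decides e r' x y c"
        unfolding total_def by blast
      then show ?thesis unfolding 1 total_or_not_def by blast
    qed (use 1 in \<open>auto simp: total_or_not_def intro: exI[of _ q]\<close>)
  next
    case (2 e)
    show ?thesis
    proof (cases "settles e q")
      case False
      then obtain r x where "r \<sqsubseteq> q" "\<forall>r' c. r' \<sqsubseteq> r \<longrightarrow> \<not> lims e r' x c"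
        unfolding settles_def by blast
      then show ?thesis unfolding 2 settles_or_not_def by blast
    qed (use 2 in \<open>auto simp: settles_or_not_def intro: exI[of _ q]\<close>)
  next
    case (3 e x c N)
    show ?thesis
    proof (cases "\<forall>r y. r \<sqsubseteq> q \<and> N \<le> y \<longrightarrow> \<not> decides e r x y c")
      case True
      then show ?thesis unfolding 3 moves_or_not_def by (auto intro: exI[of _ q])
    next
      case False
      then obtain r y where "r \<sqsubseteq> q" "N \<le> y" "decides e r x y c" by blast
      then show ?thesis unfolding 3 moves_or_not_def by blast
    qed
  next
    case (4 e)
    show ?thesis
    proof (cases "\<exists>r. r \<sqsubseteq> q \<and> total e r \<and> settles e r")
      case True
      then obtain r where r: "r \<sqsubseteq> q" "total e r" "settles e r" by blast
      interpret forcing e X r using assms(1) r(2,3) by unfold_locales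
      obtain s c where s: "s \<sqsubseteq> r" "dens e X c s" using dens_exists by blast
      have "s \<sqsubseteq> q" using s(1) r(1) by (rule below_trans)
      then show ?thesis using s(2) unfolding 4 dens_or_not_def by blast
    next
      case False
      then have "q \<in> D" unfolding 4 dens_or_not_def by blast
      then show ?thesis using below_refl by blast
    qed
  next
    case (5 e c l t N)
    show ?thesis
    proof (cases "\<exists>r. r \<sqsubseteq> q \<and> good e c r (set l) \<and> dens e X c r")
      case True
      then obtain r where r: "r \<sqsubseteq> q" "good e c r (set l)" "dens e X c r" by blast
      obtain s where s: "s \<sqsubseteq> r" "N \<le> len s" using lengthen[of r N] by blast
      obtain s' E' where s': "s' \<sqsubseteq> s" "over (X \<inter> {len s..}) (set l) E'" "good e c s' E'" "meets X t s' E'"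
        using dens_mono[OF r(3) s(1), unfolded dens_def] good_mono[OF r(2) s(1)] below_refl by blast
      have "over (X \<inter> {N..}) (set l) E'" by (rule over_mono[OF s'(2)]) (use s(2) in auto)
      then have "s' \<in> D" using s'(3,4) unfolding 5 meets_or_not_def by blast
      then show ?thesis using below_trans[OF s'(1) below_trans[OF s(1) r(1)]] by blast
    next
      case False
      then have "q \<in> D" unfolding 5 meets_or_not_def by blast
      then show ?thesis using below_refl by blast
    qed
  qed
qed

section \<open>A solution of the computed coloring that computes no homogeneous set\<close>

theorem theorem1p8:
  shows "\<not> SRT22_sc_le_SPT22"
proof
  assume reduction: "SRT22_sc_le_SPT22"
  obtain X where X: "reservoir X" using reservoir_exists by blast
  show False
  proof (rule generic_coloring[OF countable_requirements requirements_dense[OF X]])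
    fix Q f
    assume anti: "\<And>m n. n \<le> m \<Longrightarrow> Q m \<sqsubseteq> Q n" and len: "\<And>n. n \<le> len (Q n)"
      and gen: "\<And>D. D \<in> requirements X \<Longrightarrow> \<exists>n. Q n \<in> D"
      and f: "\<And>n x y. x < y \<Longrightarrow> y < len (Q n) \<Longrightarrow> f x y = pt (Q n) x y" and "stable f"
    obtain g where g: "turing_le (code g) (code f)" "stable g"
      and sol: "\<And>HL HR. p_homogeneous g HL HR
        \<Longrightarrow> \<exists>H. homogeneous f H \<and> turing_le (chi H) (chi (join HL HR))"
      using reduction \<open>stable f\<close> unfolding SRT22_sc_le_SPT22_def by blast
    obtain e where e: "\<And>n. eval (code f) e [n] (code g n)" using g(1) unfolding turing_le_def by blast
    have code_g: "code g (prod_encode (x, y)) = of_bool (g x y)" if "x < y" for x y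
      using that by (simp add: code_def)
    have dec: "g x y = c" if "x < y" "decides e (Q n) x y c" for n x y c
    proof -
      have "eval (code f) e [prod_encode (x, y)] (of_bool c)"
        using that(2) f unfolding decides_def by blast
      then have "(of_bool c :: nat) = of_bool (g x y)"
        using eval_det[OF _ e[of "prod_encode (x, y)"]] code_g[OF that(1)] by metis
      then show ?thesis by (cases c; cases "g x y") auto
    qed
    \<comment> \<open>A value of \<open>g\<close> depends on finitely many colors of
      \<open>f\<close>, all of them fixed by a late condition.\<close>
    have decided: "\<exists>n. decides e (Q n) x y (g x y)" if "x < y" for x y
    proof -
      have "eval (code f) e [prod_encode (x, y)] (of_bool (g x y))"
        using e[of "prod_encode (x, y)"] code_g[OF that] by simp
      then obtain N where N: "\<And>h. (\<And>a b. a < b \<Longrightarrow> b < N \<Longrightarrow> h a b = f a b)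
          \<Longrightarrow> eval (code h) e [prod_encode (x, y)] (of_bool (g x y))"
        using eval_code_use by blast
      have "decides e (Q N) x y (g x y)"
        unfolding decides_def
      proof (intro allI impI N)
        fix h a b assume "\<forall>a b. a < b \<and> b < len (Q N) \<longrightarrow> h a b = pt (Q N) a b" "a < b" "b < N"
        moreover from this have "b < len (Q N)" using len[of N] by simp
        ultimately show "h a b = f a b" using f by simp
      qed
      then show ?thesis ..
    qed
    obtain n1 where "Q n1 \<in> total_or_not e" using gen[OF in_requirements(1)] by blast
    moreover have "\<exists>r c. r \<sqsubseteq> Q n1 \<and> decides e r x y c" if "x < y" for x y
    proof -
      obtain n where n: "decides e (Q n) x y (g x y)" using decided \<open>x < y\<close> by blast
      have "Q (max n n1) \<sqsubseteq> Q n" "Q (max n n1) \<sqsubseteq> Q n1" by (rule anti, simp)+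
      then show ?thesis using decides_mono[OF n] by blast
    qed
    ultimately have tot: "total e (Q n1)" unfolding total_or_not_def by blast
    obtain n2 where "Q n2 \<in> settles_or_not e" using gen[OF in_requirements(2)] by blast
    moreover have "\<exists>r c. r \<sqsubseteq> Q n2 \<and> lims e r x c" for x
    proof -
      obtain c N where N: "\<And>u. N < u \<Longrightarrow> col g x u = c" using g(2)[unfolded stable_def] by meson
      \<comment> \<open>\<open>M\<close> exceeds \<open>x\<close>, so that \<open>col g x y\<close>
        is \<open>g x y\<close>, and the threshold \<open>N\<close>; from \<open>M\<close> on the
        first alternative of \<open>moves_or_not\<close> therefore fails.\<close>
      define M where "M = Suc (max x N)"
      obtain n where n: "Q n \<in> moves_or_not (e, x, \<not> c, M)" using gen[OF in_requirements(3)] by blast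
      have "\<not> decides e (Q n) x y (\<not> c)" if "M \<le> y" for y
      proof
        assume "decides e (Q n) x y (\<not> c)"
        then have "g x y = (\<not> c)" using dec[of x y n "\<not> c"] that by (simp add: M_def)
        moreover have "col g x y = g x y" using that by (simp add: M_def col_def)
        moreover have "N < y" using that by (simp add: M_def)
        ultimately show False using N[of y] by simp
      qed
      then have no: "\<not> decides e r x y (\<not> c)" if "r \<sqsubseteq> Q n" "M \<le> y" for r y
        using n that unfolding moves_or_not_def by auto
      let ?k = "max M (max n n2)"
      have "lims e (Q ?k) x c"
        unfolding lims_def
      proof (intro conjI allI impI)
        have "x < M" by (simp add: M_def)
        then show "x < len (Q ?k)" using len[of ?k] by simp
        fix r y assume r: "r \<sqsubseteq> Q ?k \<and> len (Q ?k) \<le> y"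
        then have "r \<sqsubseteq> Q n" using below_trans[OF _ anti[of n ?k]] by simp
        moreover have "M \<le> y" using r len[of ?k] by simp
        ultimately show "\<not> decides e r x y (\<not> c)" by (rule no)
      qed
      moreover have "Q ?k \<sqsubseteq> Q n2" by (rule anti) simp
      ultimately show ?thesis by blast
    qed
    ultimately have set: "settles e (Q n2)" unfolding settles_or_not_def by blast
    obtain n4 where n4: "Q n4 \<in> dens_or_not X e" using gen[OF in_requirements(4)] by blast
    let ?n = "max n1 (max n2 n4)"
    have below: "Q ?n \<sqsubseteq> Q n1" "Q ?n \<sqsubseteq> Q n2" "Q ?n \<sqsubseteq> Q n4" by (rule anti, simp)+
    then have "total e (Q ?n) \<and> settles e (Q ?n)" using tot set total_mono settles_mono by blast
    then obtain c where c: "dens e X c (Q n4)" using n4 below(3) unfolding dens_or_not_def by blast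
    \<comment> \<open>The step from stem \<open>n\<close> to stem \<open>Suc n\<close> meets the
      requirement \<open>from_nat n\<close>; the bound \<open>n \<le> i\<close> makes the conditions
      arbitrarily long.\<close>
    have "\<exists>h. \<forall>n. (case h n of (i, E) \<Rightarrow> n4 \<le> i \<and> n \<le> i \<and> good e c (Q i) E) \<and>
        (case (h n, h (Suc n)) of ((i, E), (i', E')) \<Rightarrow>
          i \<le> i' \<and> over (X \<inter> {len (Q i)..}) E E' \<and> meets X (from_nat n) (Q i') E')"
    proof (rule dependent_nat_choice)
      show "\<exists>h. case h of (i, E) \<Rightarrow> n4 \<le> i \<and> 0 \<le> i \<and> good e c (Q i) E"
        by (rule exI[of _ "(n4, {})"]) simp
    next
      fix h :: "nat \<times> nat set" and n
      assume "case h of (i, E) \<Rightarrow> n4 \<le> i \<and> n \<le> i \<and> good e c (Q i) E"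
      then obtain i E where h: "h = (i, E)" and i: "n4 \<le> i" "n \<le> i" "good e c (Q i) E" by (cases h) auto
      obtain l where l: "E = set l" using finite_list[OF good_finite[OF i(3)]] by blast
      obtain m where m: "Q m \<in> meets_or_not X (e, c, l, from_nat n, len (Q i))"
        using gen[OF in_requirements(5)] by blast
      let ?k = "Suc (max i m)"
      have ki: "Q ?k \<sqsubseteq> Q i" and km: "Q ?k \<sqsubseteq> Q m" by (rule anti, simp)+
      have "Q ?k \<sqsubseteq> Q n4" using i(1) by (intro anti) simp
      then have "good e c (Q ?k) (set l) \<and> dens e X c (Q ?k)"
        using good_mono[OF i(3) ki] dens_mono[OF c] l by blast
      then obtain E' where E': "over (X \<inter> {len (Q i)..}) E E'" "good e c (Q m) E'"
        "meets X (from_nat n) (Q m) E'"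
        using m km unfolding meets_or_not_def l by blast
      have "n4 \<le> ?k" "Suc n \<le> ?k" "i \<le> ?k" using i by auto
      then show "\<exists>h'. (case h' of (i, E) \<Rightarrow> n4 \<le> i \<and> Suc n \<le> i \<and> good e c (Q i) E) \<and>
          (case (h, h') of ((i, E), (i', E')) \<Rightarrow>
            i \<le> i' \<and> over (X \<inter> {len (Q i)..}) E E' \<and> meets X (from_nat n) (Q i') E')"
        using E'(1) good_mono[OF E'(2) km] meets_mono[OF E'(3) km] h
        by (intro exI[of _ "(?k, E')"]) simp
    qed
    then obtain h where h: "\<And>n. (case h n of (i, E) \<Rightarrow> n4 \<le> i \<and> n \<le> i \<and> good e c (Q i) E) \<and>
        (case (h n, h (Suc n)) of ((i, E), (i', E')) \<Rightarrow>
          i \<le> i' \<and> over (X \<inter> {len (Q i)..}) E E' \<and> meets X (from_nat n) (Q i') E')" by blast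
    define R E where "R n = Q (fst (h n))" and "E n = snd (h n)" for n
    have len_R: "n \<le> len (R n)" and good: "good e c (R n) (E n)"
      and over_Suc: "over (X \<inter> {len (R n)..}) (E n) (E (Suc n))"
      and R_Suc: "R (Suc n) \<sqsubseteq> R n" and met: "meets X (from_nat n) (R (Suc n)) (E (Suc n))" for n
      using h[of n] anti[of "fst (h n)" "fst (h (Suc n))"] len[of "fst (h n)"]
      unfolding R_def E_def by (simp_all add: case_prod_beta)
    have over_le: "over (X \<inter> {len (R n)..}) (E n) (E m)" if "n \<le> m" for n m
      using that
    proof (induction m rule: dec_induct)
      case base
      show ?case using good_finite[OF good] good_inj[OF good] by (rule over_refl)
    next
      case (step m)
      show ?case
        by (rule over_step[OF step.IH over_Suc subset_refl])
          (use below_len[OF antimono_below[of R, OF R_Suc step.hyps(1)]] in simp)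
    qed
    have E_mono: "mono E" using over_subset[OF over_le] by (simp add: mono_def)
    define A where "A = \<Union> (range E)"
    have E_A: "E n \<subseteq> A" for n unfolding A_def by blast
    \<comment> \<open>Later stems add only codes from \<open>2 * len (R n)\<close> on, so a
      computation secured at a stage is a computation from \<open>A\<close>.\<close>
    have A_below: "A \<inter> {..<2 * len (R n)} = E n \<inter> {..<2 * len (R n)}" for n
    proof (intro equalityI subsetI)
      fix k assume "k \<in> A \<inter> {..<2 * len (R n)}"
      then obtain m where m: "k \<in> E m" "k < 2 * len (R n)" unfolding A_def by blast
      have "k \<in> E (max n m)" using monoD[OF E_mono, of m "max n m"] m(1) by auto
      then show "k \<in> E n \<inter> {..<2 * len (R n)}" using over_below[OF over_le[of n "max n m"]] m(2) by auto
    qed (use E_A in blast)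
    define L L' where "L = {x. 2 * x \<in> A}" and "L' = {x. 2 * x + 1 \<in> A}"
    have join: "join L L' = A"
    proof (intro equalityI subsetI)
      fix k assume "k \<in> A"
      then show "k \<in> join L L'"
        by (cases "even k") (auto simp: join_def L_def L'_def elim!: evenE oddE)
    qed (auto simp: join_def L_def L'_def)
    have large: "\<exists>k\<in>A. N \<le> k \<and> odd k = s" for N s
      using met[of "to_nat (Inr (N, s) :: recf + nat \<times> bool)"] E_A by (auto simp: meets_def)
    have "\<exists>x\<ge>N. x \<in> L" for N
    proof -
      obtain k where "k \<in> A" "2 * N \<le> k" "even k" using large[of "2 * N" False] by blast
      then show ?thesis by (intro exI[of _ "k div 2"]) (auto simp: L_def)
    qed
    moreover have "\<exists>x\<ge>N. x \<in> L'" for N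
    proof -
      obtain k where "k \<in> A" "2 * N \<le> k" "odd k" using large[of "2 * N" True] by blast
      then show ?thesis by (intro exI[of _ "k div 2"]) (auto simp: L'_def)
    qed
    ultimately have "infinite L" "infinite L'" by (simp_all add: infinite_nat_iff_unbounded_le)
    moreover have "col g x y = c" if "x \<in> L" "y \<in> L'" "x \<noteq> y" for x y
    proof -
      have "2 * x \<in> A" "2 * y + 1 \<in> A" using that by (auto simp: L_def L'_def)
      then obtain n m where "2 * x \<in> E n" "2 * y + 1 \<in> E m" unfolding A_def by blast
      then have k: "2 * x \<in> E (max n m)" "2 * y + 1 \<in> E (max n m)"
        using monoD[OF E_mono, of n "max n m"] monoD[OF E_mono, of m "max n m"] by auto
      show ?thesis
      proof (cases "x < y")
        case True
        then show ?thesis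
          using dec[OF True] good_decides[OF good k] unfolding R_def by (simp add: col_def)
      next
        case False
        then have "y < x" using that(3) by simp
        then show ?thesis
          using dec[OF \<open>y < x\<close>] good_decides[OF good k(2,1)] unfolding R_def by (simp add: col_def)
      qed
    qed
    ultimately have "p_homogeneous g L L'"
      unfolding p_homogeneous_def by (intro conjI exI[of _ c]) simp_all
    from sol[OF this] obtain H where H: "homogeneous f H" "turing_le (chi H) (chi A)"
      unfolding join by blast
    then obtain \<psi> where \<psi>: "\<And>n. eval (chi A) \<psi> [n] (chi H n)" unfolding turing_le_def by blast
    have H_iff: "w \<in> H \<longleftrightarrow> eval (chi A) \<psi> [w] 1" for w
      using eval_det[OF \<psi>[of w], of 1] \<psi>[of w] by (auto simp: chi_def split: if_splits)
    let ?n = "Suc (to_nat (Inl \<psi> :: recf + nat \<times> bool))"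
    have "win X \<psi> (R ?n) (E ?n)"
      using met[of "to_nat (Inl \<psi> :: recf + nat \<times> bool)"] by (simp add: meets_def)
    then show False
      unfolding win_def
    proof (elim disjE exE conjE)
      fix a b a' b' assume *: "a < b" "b < len (R ?n)" "a' < b'" "b' < len (R ?n)"
        "pt (R ?n) a b \<noteq> pt (R ?n) a' b'" "\<forall>w\<in>{a, b, a', b'}. computes \<psi> (2 * len (R ?n)) (E ?n) w"
      have "w \<in> H" if "w \<in> {a, b, a', b'}" for w
        using *(6) that computes_eval[OF _ A_below] H_iff by blast
      moreover have "f a b \<noteq> f a' b'" using * f unfolding R_def by metis
      ultimately show False using H(1) *(1,3) unfolding homogeneous_def by (metis insertCI)
    next
      \<comment> \<open>As \<open>H\<close> is infinite, \<open>A\<close> prints some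
        \<open>w\<close> from \<open>N\<close> on; a stem covering the use of this computation
        prints it as well.\<close>
      fix N assume dead: "\<forall>E'. over (X \<inter> {len (R ?n)..}) (E ?n) E' \<longrightarrow> \<not> prints_from \<psi> N E'"
      obtain w where w: "w \<in> H" "N \<le> w" using H(1) infinite_natD unfolding homogeneous_def by blast
      then have "eval (chi A) \<psi> [w] 1" using H_iff by blast
      then obtain m where m: "computes \<psi> m A w" by (rule eval_computes)
      let ?j = "max ?n m"
      have "m \<le> 2 * len (R ?j)" using len_R[of ?j] by simp
      then have "computes \<psi> (2 * len (R ?j)) (E ?j) w"
      proof (rule computes_mono[OF m])
        have "{..<2 * len (R ?j)} \<inter> {..<m} = {..<m}" using len_R[of ?j] by auto
        then show "E ?j \<inter> {..<m} = A \<inter> {..<m}" using A_below[of ?j] by (metis Int_assoc)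
      qed
      then have "prints_from \<psi> N (E ?j)" using w(2) computes_prints unfolding prints_from_def by blast
      then show False using dead over_le[of ?n ?j] by simp
    qed
  qed
qed

end
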